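(* Let $S$ be a proper restriction semigroup which acts (non-degenerately) on a locally compact Hausdorff space $X$ via $\theta\colon S\to\mathcal{PT}(X)$. Let $T=S/\sigma$ and let $\overline\theta$ be the partial action of $T$ on $X$ given, for $t\in T$, by $$\mathrm{dom}(\overline\theta_t)=\bigcup_{s\in S,\,[s]_\sigma=t}\mathrm{dom}(\theta_s),\qquad \overline\theta_t(x)=\theta_u(x),$$ where $u\in S$ is any element with $[u]_\sigma=t$ and $x\in\mathrm{dom}(\theta_u)$. Then the topological categories $T\ltimes_{\overline\theta}X$ (the partial transformation category of $\overline\theta$) and $S\ltimes_\theta X$ (the category of germs of $\theta$) are isomorphic as topological categories, i.e. there is a functor between them that is a homeomorphism.
   Context: **Restriction semigroups.** A restriction semigroup is an algebra $(S;\cdot,{}^* )$ where $(S;\cdot)$ is a semigroup and ${}^*$ is a unary operation with $xx^*=x$, $x^*y^*=y^*x^*=(x^*y^* )^*$, $(xy)^*=(x^*y)^*$, $x^*y=y(xy)^*$. Put $P(S)=\{s^*:s\in S\}$ (projections; a semilattice). The natural partial order is $s\le t\Leftrightarrow s=ts^*$. $\sigma$ is the minimum $(\cdot,{}^* )$-congruence on $S$ identifying all projections; $[s]_\sigma$ is the $\sigma$-class of $s$, and $S/\sigma$ is a monoid whose identity is the class of projections. $S$ is proper if $s\mathrel\sigma t$ and $s^*=t^*$ imply $s=t$. **Categories.** A (small) category is identified with its set $\mathcal C$ of arrows, units $\mathcal C^{(0)}\subseteq\mathcal C$, domain and range maps $\mathbf d,\mathbf r$, with $xy$ defined iff $\mathbf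 r(y)=\mathbf d(x)$. It is topological if $\mathbf d,\mathbf r$ and multiplication are continuous. **Actions and germs.** $\mathcal{PT}(X)$ is the restriction monoid of continuous partial self-maps of $X$ with open domains, under composition of partial maps (right to left), with $f^*=\mathrm{id}_{\mathrm{dom}(f)}$. An action of $S$ on $X$ is a $(\cdot,{}^* )$-morphism $\theta\colon S\to\mathcal{PT}(X)$ that is non-degenerate: $\bigcup_{e\in P(S)}X_e=X$ where $X_e=\mathrm{dom}(\theta_e)$; then $\mathrm{dom}(\theta_s)=X_{s^*}$. On $\Omega=\{(s,x)\in S\times X:x\in X_{s^*}\}$ put $(s,x)\sim(t,y)$ iff $x=y$ and there is $u\le s,t$ with $x\in X_{u^*}$; the class of $(s,x)$ is the germ $[s,x]$. The category of germs $S\ltimes_\theta X=\Omega/{\sim}$ has $\mathbf d([s,x])=[s^*,x]$, $\mathbf r([s,x])=[e,\theta_s(x)]$ for any $e\in P(S)$ with $\theta_s(x)\in X_e$, product $[s,\theta_t(y)][t,y]=[st,y]$, and topology with basis the sets $(s,U)=\{[s,x]:x\in U\}$, $s\in S$, $U\subseteq X_{s^*}$ open. **Partial actions of monoids.** A partial action of a monoid $T$ on $X$ is a map $\alpha\colon T\to\mathcal{PT}(X)$ with $\alpha_1=\mathrm{id}_X$ and $\alpha_s\alpha_t\le\alpha_{st}$ (i.e. $\alpha_{st}$ extends $\alpha_s\alpha_t$). Its partial transformation category $T\ltimes_\alpha X$ is the set of $(s,x)\in T\times X$ with $x\in\mathrm{dom}(\alpha_s)$, with the relative topology from $T\times X$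 ($T$ discrete), $\mathbf d(s,x)=(1,x)$, $\mathbf r(s,x)=(1,\alpha_s(x))$, and $(s,x)(t,y)$ defined iff $\alpha_t(y)=x$, in which case it equals $(st,y)$. *)

theory Defs
  imports "HOL-Analysis.Analysis" "HOL-Algebra.Group"
begin

section \<open>Restriction semigroups\<close>

record 'a rsemigroup = "'a partial_object" +
  smult :: "['a, 'a] \<Rightarrow> 'a" (infixl \<open>\<cdot>\<index>\<close> 70)
  star :: "'a \<Rightarrow> 'a"

text \<open>As usual, semigroups are nonempty; otherwise the quotient by \<open>\<sigma>\<close> would have no identity.\<close>

locale restriction_semigroup =
  fixes S :: "('a, 'b) rsemigroup_scheme" (structure)
  assumes nonempty: "carrier S \<noteq> {}"
    and m_closed: "\<lbrakk>x \<in> carrier S; y \<in> carrier S\<rbrakk> \<Longrightarrow> x \<cdot> y \<in> carrier S"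
    and star_closed: "x \<in> carrier S \<Longrightarrow> star S x \<in> carrier S"
    and m_assoc: "\<lbrakk>x \<in> carrier S; y \<in> carrier S; z \<in> carrier S\<rbrakk> \<Longrightarrow> (x \<cdot> y) \<cdot> z = x \<cdot> (y \<cdot> z)"
    and m_star: "x \<in> carrier S \<Longrightarrow> x \<cdot> star S x = x"
    and star_comm: "\<lbrakk>x \<in> carrier S; y \<in> carrier S\<rbrakk> \<Longrightarrow> star S x \<cdot> star S y = star S y \<cdot> star S x"
    and star_m_star: "\<lbrakk>x \<in> carrier S; y \<in> carrier S\<rbrakk> \<Longrightarrow>
      star S x \<cdot> star S y = star S (star S x \<cdot> star S y)"
    and star_m: "\<lbrakk>x \<in> carrier S; y \<in> carrier S\<rbrakk> \<Longrightarrow> star S (x \<cdot> y) = star S (star S x \<cdot> y)"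
    and ample: "\<lbrakk>x \<in> carrier S; y \<in> carrier S\<rbrakk> \<Longrightarrow> star S x \<cdot> y = y \<cdot> star S (x \<cdot> y)"

definition projections :: "('a, 'b) rsemigroup_scheme \<Rightarrow> 'a set" where
  "projections S = star S ` carrier S"

definition natural_le :: "('a, 'b) rsemigroup_scheme \<Rightarrow> 'a \<Rightarrow> 'a \<Rightarrow> bool" where
  "natural_le S s t \<longleftrightarrow> s = t \<cdot>\<^bsub>S\<^esub> star S s"

definition rs_congruence :: "('a, 'b) rsemigroup_scheme \<Rightarrow> ('a \<times> 'a) set \<Rightarrow> bool" where
  "rs_congruence S \<rho> \<longleftrightarrow> equiv (carrier S) \<rho> \<and>
     (\<forall>(a, b) \<in> \<rho>. \<forall>(c, d) \<in> \<rho>. (a \<cdot>\<^bsub>S\<^esub> c, b \<cdot>\<^bsub>S\<^esub> d) \<in> \<rho>) \<and>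
     (\<forall>(a, b) \<in> \<rho>. (star S a, star S b) \<in> \<rho>)"

definition sigma_rel :: "('a, 'b) rsemigroup_scheme \<Rightarrow> ('a \<times> 'a) set" where
  "sigma_rel S = \<Inter>{\<rho>. rs_congruence S \<rho> \<and> projections S \<times> projections S \<subseteq> \<rho>}"

definition sigma_class :: "('a, 'b) rsemigroup_scheme \<Rightarrow> 'a \<Rightarrow> 'a set" where
  "sigma_class S s = sigma_rel S `` {s}"

text \<open>Product and identity are unions of classes, all of which coincide; see
  \<open>sigma_quotient_mult\<close> and \<open>sigma_quotient_one\<close> below.\<close>

definition sigma_quotient :: "('a, 'b) rsemigroup_scheme \<Rightarrow> 'a set monoid" where
  "sigma_quotient S =
     \<lparr>carrier = carrier S // sigma_rel S,
      mult = (\<lambda>A B. \<Union>a\<in>A. \<Union>b\<in>B. sigma_class S (a \<cdot>\<^bsub>S\<^esub> b)),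
      one = (\<Union>e\<in>projections S. sigma_class S e)\<rparr>"

locale proper_restriction_semigroup = restriction_semigroup +
  assumes proper: "\<lbrakk>(s, t) \<in> sigma_rel S; star S s = star S t\<rbrakk> \<Longrightarrow> s = t"

definition rs_hom ::
    "('a, 'c) rsemigroup_scheme \<Rightarrow> ('b, 'd) rsemigroup_scheme \<Rightarrow> ('a \<Rightarrow> 'b) \<Rightarrow> bool" where
  "rs_hom S R h \<longleftrightarrow> h \<in> carrier S \<rightarrow> carrier R \<and>
     (\<forall>x\<in>carrier S. \<forall>y\<in>carrier S. h (x \<cdot>\<^bsub>S\<^esub> y) = h x \<cdot>\<^bsub>R\<^esub> h y) \<and>
     (\<forall>x\<in>carrier S. h (star S x) = star R (h x))"


section \<open>Partial self-maps, actions and partial actions\<close>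

definition PT :: "'x topology \<Rightarrow> ('x \<rightharpoonup> 'x) rsemigroup" where
  "PT X =
     \<lparr>carrier = {f. openin X (dom f) \<and>
                    continuous_map (subtopology X (dom f)) X (\<lambda>x. the (f x))},
      smult = (\<lambda>f g. f \<circ>\<^sub>m g),
      star = (\<lambda>f. Some |` dom f)\<rparr>"

definition rs_action ::
    "('a, 'b) rsemigroup_scheme \<Rightarrow> 'x topology \<Rightarrow> ('a \<Rightarrow> 'x \<rightharpoonup> 'x) \<Rightarrow> bool" where
  "rs_action S X \<theta> \<longleftrightarrow> rs_hom S (PT X) \<theta> \<and> (\<Union>e\<in>projections S. dom (\<theta> e)) = topspace X"

definition partial_action ::
    "('t, 'm) monoid_scheme \<Rightarrow> 'x topology \<Rightarrow> ('t \<Rightarrow> 'x \<rightharpoonup> 'x) \<Rightarrow> bool" where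
  "partial_action T X \<alpha> \<longleftrightarrow> \<alpha> \<in> carrier T \<rightarrow> carrier (PT X) \<and>
     \<alpha> \<one>\<^bsub>T\<^esub> = Some |` topspace X \<and>
     (\<forall>s\<in>carrier T. \<forall>t\<in>carrier T. \<alpha> s \<circ>\<^sub>m \<alpha> t \<subseteq>\<^sub>m \<alpha> (s \<otimes>\<^bsub>T\<^esub> t))"

text \<open>The partial action of \<open>S/\<sigma>\<close> induced by an action of \<open>S\<close>. That the value does not
  depend on the choice of \<open>u\<close> when \<open>S\<close> is proper is \<open>induced_partial_action_eq\<close>
  below.\<close>

definition induced_partial_action ::
    "('a, 'b) rsemigroup_scheme \<Rightarrow> ('a \<Rightarrow> 'x \<rightharpoonup> 'x) \<Rightarrow> 'a set \<Rightarrow> 'x \<rightharpoonup> 'x" where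
  "induced_partial_action S \<theta> t x =
     (if x \<in> (\<Union>s\<in>{s \<in> carrier S. sigma_class S s = t}. dom (\<theta> s))
      then \<theta> (SOME u. u \<in> carrier S \<and> sigma_class S u = t \<and> x \<in> dom (\<theta> u)) x
      else None)"


section \<open>Topological categories\<close>

text \<open>A small category is its set of arrows, the objects being the units; \<open>catmult C x y\<close>
  is meaningful only if \<open>cran C y = cdom C x\<close>.\<close>

record 'c topcat =
  arrows :: "'c set"
  units :: "'c set"
  cdom :: "'c \<Rightarrow> 'c"
  cran :: "'c \<Rightarrow> 'c"
  catmult :: "'c \<Rightarrow> 'c \<Rightarrow> 'c"
  arrow_topology :: "'c topology"

definition composable :: "('c, 'm) topcat_scheme \<Rightarrow> ('c \<times> 'c) set" where
  "composable C = {(x, y). x \<in> arrows C \<and> y \<in> arrows C \<and> cran C y = cdom C x}"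

locale topological_category =
  fixes C :: "('c, 'm) topcat_scheme"
  assumes units_subset: "units C \<subseteq> arrows C"
    and cdom_closed: "x \<in> arrows C \<Longrightarrow> cdom C x \<in> units C"
    and cran_closed: "x \<in> arrows C \<Longrightarrow> cran C x \<in> units C"
    and cdom_unit: "u \<in> units C \<Longrightarrow> cdom C u = u"
    and cran_unit: "u \<in> units C \<Longrightarrow> cran C u = u"
    and catmult_closed: "(x, y) \<in> composable C \<Longrightarrow> catmult C x y \<in> arrows C"
    and cdom_catmult: "(x, y) \<in> composable C \<Longrightarrow> cdom C (catmult C x y) = cdom C y"
    and cran_catmult: "(x, y) \<in> composable C \<Longrightarrow> cran C (catmult C x y) = cran C x"
    and catmult_cdom: "x \<in> arrows C \<Longrightarrow> catmult C x (cdom C x) = x"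
    and cran_catmult_self: "x \<in> arrows C \<Longrightarrow> catmult C (cran C x) x = x"
    and catmult_assoc: "\<lbrakk>(x, y) \<in> composable C; (y, z) \<in> composable C\<rbrakk> \<Longrightarrow>
      catmult C (catmult C x y) z = catmult C x (catmult C y z)"
    and topspace_arrow_topology: "topspace (arrow_topology C) = arrows C"
    and continuous_cdom: "continuous_map (arrow_topology C) (arrow_topology C) (cdom C)"
    and continuous_cran: "continuous_map (arrow_topology C) (arrow_topology C) (cran C)"
    and continuous_catmult:
      "continuous_map
         (subtopology (prod_topology (arrow_topology C) (arrow_topology C)) (composable C))
         (arrow_topology C) (\<lambda>(x, y). catmult C x y)"

definition is_functor ::
    "('c, 'm) topcat_scheme \<Rightarrow> ('d, 'n) topcat_scheme \<Rightarrow> ('c \<Rightarrow> 'd) \<Rightarrow> bool" where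
  "is_functor C D F \<longleftrightarrow> F \<in> arrows C \<rightarrow> arrows D \<and> F \<in> units C \<rightarrow> units D \<and>
     (\<forall>x\<in>arrows C. F (cdom C x) = cdom D (F x) \<and> F (cran C x) = cran D (F x)) \<and>
     (\<forall>(x, y)\<in>composable C. F (catmult C x y) = catmult D (F x) (F y))"

definition isomorphic_topological_categories ::
    "('c, 'm) topcat_scheme \<Rightarrow> ('d, 'n) topcat_scheme \<Rightarrow> bool" where
  "isomorphic_topological_categories C D \<longleftrightarrow>
     topological_category C \<and> topological_category D \<and>
     (\<exists>F. is_functor C D F \<and> homeomorphic_map (arrow_topology C) (arrow_topology D) F)"


section \<open>The partial transformation category\<close>

definition transformation_arrows ::
    "('t, 'm) monoid_scheme \<Rightarrow> ('t \<Rightarrow> 'x \<rightharpoonup> 'x) \<Rightarrow> ('t \<times> 'x) set" where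
  "transformation_arrows T \<alpha> = {(s, x). s \<in> carrier T \<and> x \<in> dom (\<alpha> s)}"

definition transformation_category ::
    "('t, 'm) monoid_scheme \<Rightarrow> 'x topology \<Rightarrow> ('t \<Rightarrow> 'x \<rightharpoonup> 'x) \<Rightarrow> ('t \<times> 'x) topcat" where
  "transformation_category T X \<alpha> =
     \<lparr>arrows = transformation_arrows T \<alpha>,
      units = {\<one>\<^bsub>T\<^esub>} \<times> topspace X,
      cdom = (\<lambda>(s, x). (\<one>\<^bsub>T\<^esub>, x)),
      cran = (\<lambda>(s, x). (\<one>\<^bsub>T\<^esub>, the (\<alpha> s x))),
      catmult = (\<lambda>(s, x) (t, y). (s \<otimes>\<^bsub>T\<^esub> t, y)),
      arrow_topology = subtopology (prod_topology (discrete_topology (carrier T)) X)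
                         (transformation_arrows T \<alpha>)\<rparr>"


section \<open>The category of germs\<close>

text \<open>Germs are equivalence classes of pairs, and the structure maps are given on
  representatives by definite description; \<open>germ_cdom_germ\<close>, \<open>germ_cran_germ\<close> and
  \<open>germ_mult_germ\<close> below show that they do not depend on the choices.  Likewise
  \<open>openin_germ_topology\<close> shows that the basic open sets are a base of a topology.\<close>

definition germ_domain ::
    "('a, 'b) rsemigroup_scheme \<Rightarrow> ('a \<Rightarrow> 'x \<rightharpoonup> 'x) \<Rightarrow> ('a \<times> 'x) set" where
  "germ_domain S \<theta> = {(s, x). s \<in> carrier S \<and> x \<in> dom (\<theta> (star S s))}"

definition germ_rel ::
    "('a, 'b) rsemigroup_scheme \<Rightarrow> ('a \<Rightarrow> 'x \<rightharpoonup> 'x) \<Rightarrow> (('a \<times> 'x) \<times> ('a \<times> 'x)) set" where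
  "germ_rel S \<theta> = {((s, x), (t, y)).
     (s, x) \<in> germ_domain S \<theta> \<and> (t, y) \<in> germ_domain S \<theta> \<and> x = y \<and>
     (\<exists>u\<in>carrier S. natural_le S u s \<and> natural_le S u t \<and> x \<in> dom (\<theta> (star S u)))}"

definition germ ::
    "('a, 'b) rsemigroup_scheme \<Rightarrow> ('a \<Rightarrow> 'x \<rightharpoonup> 'x) \<Rightarrow> 'a \<Rightarrow> 'x \<Rightarrow> ('a \<times> 'x) set" where
  "germ S \<theta> s x = germ_rel S \<theta> `` {(s, x)}"

definition germ_cdom ::
    "('a, 'b) rsemigroup_scheme \<Rightarrow> ('a \<Rightarrow> 'x \<rightharpoonup> 'x) \<Rightarrow> ('a \<times> 'x) set \<Rightarrow> ('a \<times> 'x) set" where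
  "germ_cdom S \<theta> g = (THE h. \<exists>(s, x)\<in>germ_domain S \<theta>.
     g = germ S \<theta> s x \<and> h = germ S \<theta> (star S s) x)"

definition germ_cran ::
    "('a, 'b) rsemigroup_scheme \<Rightarrow> ('a \<Rightarrow> 'x \<rightharpoonup> 'x) \<Rightarrow> ('a \<times> 'x) set \<Rightarrow> ('a \<times> 'x) set" where
  "germ_cran S \<theta> g = (THE h. \<exists>(s, x)\<in>germ_domain S \<theta>. \<exists>e\<in>projections S.
     g = germ S \<theta> s x \<and> the (\<theta> s x) \<in> dom (\<theta> e) \<and> h = germ S \<theta> e (the (\<theta> s x)))"

definition germ_mult ::
    "('a, 'b) rsemigroup_scheme \<Rightarrow> ('a \<Rightarrow> 'x \<rightharpoonup> 'x) \<Rightarrow>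
       ('a \<times> 'x) set \<Rightarrow> ('a \<times> 'x) set \<Rightarrow> ('a \<times> 'x) set" where
  "germ_mult S \<theta> g h = (THE k. \<exists>s. \<exists>(t, y)\<in>germ_domain S \<theta>.
     (s, the (\<theta> t y)) \<in> germ_domain S \<theta> \<and>
     g = germ S \<theta> s (the (\<theta> t y)) \<and> h = germ S \<theta> t y \<and> k = germ S \<theta> (s \<cdot>\<^bsub>S\<^esub> t) y)"

definition germ_basic_open ::
    "('a, 'b) rsemigroup_scheme \<Rightarrow> ('a \<Rightarrow> 'x \<rightharpoonup> 'x) \<Rightarrow> 'a \<Rightarrow> 'x set \<Rightarrow> ('a \<times> 'x) set set" where
  "germ_basic_open S \<theta> s U = germ S \<theta> s ` U"

definition germ_topology ::
    "('a, 'b) rsemigroup_scheme \<Rightarrow> 'x topology \<Rightarrow> ('a \<Rightarrow> 'x \<rightharpoonup> 'x) \<Rightarrow> ('a \<times> 'x) set topology" where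
  "germ_topology S X \<theta> = topology (arbitrary union_of (\<lambda>B. \<exists>s\<in>carrier S. \<exists>U.
     openin X U \<and> U \<subseteq> dom (\<theta> (star S s)) \<and> B = germ_basic_open S \<theta> s U))"

definition germ_category ::
    "('a, 'b) rsemigroup_scheme \<Rightarrow> 'x topology \<Rightarrow> ('a \<Rightarrow> 'x \<rightharpoonup> 'x) \<Rightarrow> ('a \<times> 'x) set topcat" where
  "germ_category S X \<theta> =
     \<lparr>arrows = germ_domain S \<theta> // germ_rel S \<theta>,
      units = {germ S \<theta> e x |e x. e \<in> projections S \<and> x \<in> dom (\<theta> e)},
      cdom = germ_cdom S \<theta>,
      cran = germ_cran S \<theta>,
      catmult = germ_mult S \<theta>,
      arrow_topology = germ_topology S X \<theta>\<rparr>"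


section \<open>Well-definedness\<close>

context restriction_semigroup
begin

lemma proj_closed: "e \<in> projections S \<Longrightarrow> e \<in> carrier S"
  by (auto simp: projections_def star_closed)

lemma star_proj: "s \<in> carrier S \<Longrightarrow> star S s \<in> projections S"
  by (auto simp: projections_def)

lemma star_star_idem: "s \<in> carrier S \<Longrightarrow> star S s \<cdot> star S s = star S s"
  by (metis m_star star_m star_closed star_m_star)

lemma star_star: "s \<in> carrier S \<Longrightarrow> star S (star S s) = star S s"
  by (metis star_m_star star_star_idem)

lemma star_of_proj: "e \<in> projections S \<Longrightarrow> star S e = e"
  by (auto simp: projections_def star_star)

lemma star_m_proj:
  assumes "s \<in> carrier S" "e \<in> projections S"
  shows "star S (s \<cdot> e) = star S s \<cdot> e"
  using assms star_of_proj[OF assms(2)] proj_closed[OF assms(2)] star_m star_m_star by metis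

lemma proj_m: "e \<in> projections S \<Longrightarrow> f \<in> projections S \<Longrightarrow> e \<cdot> f \<in> projections S"
  using star_proj[of "e \<cdot> f"] by (simp add: star_m_proj star_of_proj m_closed proj_closed)

lemma proj_comm: "e \<in> projections S \<Longrightarrow> f \<in> projections S \<Longrightarrow> e \<cdot> f = f \<cdot> e"
  by (auto simp: projections_def star_comm)

lemma natural_leI: "s \<in> carrier S \<Longrightarrow> e \<in> projections S \<Longrightarrow> natural_le S (s \<cdot> e) s"
  unfolding natural_le_def
  by (metis m_assoc m_star proj_closed star_closed star_m_proj)

lemma natural_le_star:
  assumes "s \<in> carrier S" "t \<in> carrier S" "natural_le S s t"
  shows "star S t \<cdot> star S s = star S s"
  using assms unfolding natural_le_def by (metis star_m_proj star_proj)

lemma natural_le_trans: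
  assumes "r \<in> carrier S" "s \<in> carrier S" "t \<in> carrier S" "natural_le S r s" "natural_le S s t"
  shows "natural_le S r t"
proof -
  have "r = (t \<cdot> star S s) \<cdot> star S r"
    using assms by (simp add: natural_le_def)
  also have "\<dots> = t \<cdot> star S r"
    using assms natural_le_star by (simp add: m_assoc star_closed)
  finally show ?thesis by (simp add: natural_le_def)
qed

lemma natural_le_mult:
  assumes "u \<in> carrier S" "s \<in> carrier S" "v \<in> carrier S" "t \<in> carrier S"
    and "natural_le S u s" "natural_le S v t"
  shows "natural_le S (u \<cdot> v) (s \<cdot> t)"
proof -
  have "u \<cdot> v = s \<cdot> (star S u \<cdot> t) \<cdot> star S v"
    using assms by (metis m_assoc m_closed natural_le_def star_closed)
  also have "star S u \<cdot> t = t \<cdot> star S (u \<cdot> t)"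
    using assms ample by blast
  finally have "u \<cdot> v = (s \<cdot> t) \<cdot> (star S (u \<cdot> t) \<cdot> star S v)"
    using assms by (simp add: m_assoc m_closed star_closed)
  then show ?thesis
    using assms by (metis (no_types) m_closed natural_leI proj_m star_proj)
qed

lemma rs_congruence_total: "rs_congruence S (carrier S \<times> carrier S)"
  by (auto simp: rs_congruence_def equiv_def refl_on_def sym_def trans_def m_closed star_closed)

lemma sigma_congruence: "rs_congruence S (sigma_rel S)"
proof -
  have iff: "p \<in> sigma_rel S \<longleftrightarrow>
      (\<forall>\<rho>. rs_congruence S \<rho> \<longrightarrow> projections S \<times> projections S \<subseteq> \<rho> \<longrightarrow> p \<in> \<rho>)" for p
    by (auto simp: sigma_rel_def)
  note congD = rs_congruence_def[THEN iffD1]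
  have tot: "rs_congruence S (carrier S \<times> carrier S)"
      "projections S \<times> projections S \<subseteq> carrier S \<times> carrier S"
    using rs_congruence_total proj_closed by auto
  show ?thesis
    unfolding rs_congruence_def
  proof (intro conjI equivI)
    show "sigma_rel S \<subseteq> carrier S \<times> carrier S"
      using tot iff by blast
    show "refl_on (carrier S) (sigma_rel S)"
    proof (rule refl_onI)
      fix x assume "x \<in> carrier S"
      then show "(x, x) \<in> sigma_rel S"
        unfolding iff by (auto dest!: congD simp: equiv_def refl_on_def)
    qed
    show "sym (sigma_rel S)"
    proof (rule symI)
      fix x y assume "(x, y) \<in> sigma_rel S"
      then show "(y, x) \<in> sigma_rel S"
        unfolding iff by (meson congD equivE symD)
    qed
    show "trans (sigma_rel S)"
    proof (rule transI)
      fix x y z assume "(x, y) \<in> sigma_rel S" "(y, z) \<in> sigma_rel S"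
      then show "(x, z) \<in> sigma_rel S"
        unfolding iff by (meson congD equivE transD)
    qed
    show "\<forall>(a, b)\<in>sigma_rel S. \<forall>(c, d)\<in>sigma_rel S. (a \<cdot> c, b \<cdot> d) \<in> sigma_rel S"
    proof clarify
      fix a b c d assume 1: "(a, b) \<in> sigma_rel S" "(c, d) \<in> sigma_rel S"
      show "(a \<cdot> c, b \<cdot> d) \<in> sigma_rel S"
        unfolding iff
      proof (intro allI impI)
        fix \<rho> assume \<rho>: "rs_congruence S \<rho>" "projections S \<times> projections S \<subseteq> \<rho>"
        then have "(a, b) \<in> \<rho>" "(c, d) \<in> \<rho>" using 1 iff by auto
        then show "(a \<cdot> c, b \<cdot> d) \<in> \<rho>" using congD[OF \<rho>(1)] by fast
      qed
    qed
    show "\<forall>(a, b)\<in>sigma_rel S. (star S a, star S b) \<in> sigma_rel S"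
    proof clarify
      fix a b assume 1: "(a, b) \<in> sigma_rel S"
      show "(star S a, star S b) \<in> sigma_rel S"
        unfolding iff
      proof (intro allI impI)
        fix \<rho> assume \<rho>: "rs_congruence S \<rho>" "projections S \<times> projections S \<subseteq> \<rho>"
        then have "(a, b) \<in> \<rho>" using 1 iff by auto
        then show "(star S a, star S b) \<in> \<rho>" using congD[OF \<rho>(1)] by fast
      qed
    qed
  qed
qed

lemma sigma_equiv: "equiv (carrier S) (sigma_rel S)"
  using sigma_congruence by (simp add: rs_congruence_def)

lemma sigma_m: "(a, b) \<in> sigma_rel S \<Longrightarrow> (c, d) \<in> sigma_rel S \<Longrightarrow> (a \<cdot> c, b \<cdot> d) \<in> sigma_rel S"
  using sigma_congruence by (auto simp: rs_congruence_def)

lemma sigma_proj: "e \<in> projections S \<Longrightarrow> f \<in> projections S \<Longrightarrow> (e, f) \<in> sigma_rel S"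
  by (auto simp: sigma_rel_def)

lemma sigma_class_eq_iff:
  "s \<in> carrier S \<Longrightarrow> t \<in> carrier S \<Longrightarrow> sigma_class S s = sigma_class S t \<longleftrightarrow> (s, t) \<in> sigma_rel S"
  unfolding sigma_class_def by (rule eq_equiv_class_iff[OF sigma_equiv])

lemma sigma_refl: "s \<in> carrier S \<Longrightarrow> (s, s) \<in> sigma_rel S"
  using sigma_equiv by (simp add: equiv_def refl_on_def)

lemma sigma_m_proj:
  assumes "s \<in> carrier S" "e \<in> projections S"
  shows "(s, s \<cdot> e) \<in> sigma_rel S"
proof -
  have "(s \<cdot> star S s, s \<cdot> e) \<in> sigma_rel S"
    by (rule sigma_m[OF sigma_refl[OF assms(1)] sigma_proj[OF star_proj[OF assms(1)] assms(2)]])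
  then show ?thesis using m_star[OF assms(1)] by simp
qed

lemma sigma_quotient_carrier: "carrier (sigma_quotient S) = sigma_class S ` carrier S"
  by (auto simp: sigma_quotient_def sigma_class_def quotient_def)

lemma sigma_quotient_mult:
  assumes "s \<in> carrier S" "t \<in> carrier S"
  shows "sigma_class S s \<otimes>\<^bsub>sigma_quotient S\<^esub> sigma_class S t = sigma_class S (s \<cdot> t)"
proof -
  have "sigma_class S (a \<cdot> b) = sigma_class S (s \<cdot> t)"
    if "a \<in> sigma_class S s" "b \<in> sigma_class S t" for a b
  proof -
    have "(s, a) \<in> sigma_rel S" "(t, b) \<in> sigma_rel S"
      using that by (auto simp: sigma_class_def)
    then have "(s \<cdot> t, a \<cdot> b) \<in> sigma_rel S" by (rule sigma_m)
    then show ?thesis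
      using equiv_class_eq[OF sigma_equiv] by (simp add: sigma_class_def)
  qed
  then have "(\<Union>a\<in>sigma_class S s. \<Union>b\<in>sigma_class S t. sigma_class S (a \<cdot> b)) =
      (\<Union>a\<in>sigma_class S s. \<Union>b\<in>sigma_class S t. sigma_class S (s \<cdot> t))"
    by (intro SUP_cong refl)
  also have "\<dots> = sigma_class S (s \<cdot> t)"
    using assms sigma_refl by (auto simp: sigma_class_def)
  finally have "(\<Union>a\<in>sigma_class S s. \<Union>b\<in>sigma_class S t. sigma_class S (a \<cdot> b)) =
      sigma_class S (s \<cdot> t)" .
  then show ?thesis by (simp add: sigma_quotient_def)
qed

lemma sigma_quotient_one:
  assumes "e \<in> projections S"
  shows "\<one>\<^bsub>sigma_quotient S\<^esub> = sigma_class S e"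
proof -
  have "sigma_class S f = sigma_class S e" if "f \<in> projections S" for f
    using assms that by (simp add: sigma_class_eq_iff proj_closed sigma_proj)
  then have "(\<Union>f\<in>projections S. sigma_class S f) = (\<Union>f\<in>projections S. sigma_class S e)"
    by (intro SUP_cong refl)
  also have "\<dots> = sigma_class S e"
    using assms by auto
  finally have "(\<Union>f\<in>projections S. sigma_class S f) = sigma_class S e" .
  then show ?thesis by (simp add: sigma_quotient_def)
qed

lemma monoid_sigma_quotient: "monoid (sigma_quotient S)"
proof -
  obtain s where "s \<in> carrier S" using nonempty by blast
  then obtain e where e: "e \<in> projections S" using star_proj by blast
  have e1: "e \<in> carrier S" using e by (rule proj_closed)
  have l: "sigma_class S (e \<cdot> s) = sigma_class S s" if s: "s \<in> carrier S" for s
  proof -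
    have "s \<cdot> star S (e \<cdot> s) = e \<cdot> s"
      using ample[OF e1 s] unfolding star_of_proj[OF e] by (rule sym)
    then have "(s, e \<cdot> s) \<in> sigma_rel S"
      using sigma_m_proj[OF s star_proj[OF m_closed[OF e1 s]]] by simp
    then show ?thesis
      using sigma_class_eq_iff[OF s m_closed[OF e1 s]] by simp
  qed
  have r: "sigma_class S (s \<cdot> e) = sigma_class S s" if s: "s \<in> carrier S" for s
    using sigma_m_proj[OF s e] sigma_class_eq_iff[OF s m_closed[OF s e1]] by simp
  show ?thesis
    by (rule monoidI) (use e1 in \<open>auto simp: sigma_quotient_carrier sigma_quotient_mult
        sigma_quotient_one[OF e] m_closed m_assoc l r\<close>)
qed

end

lemma (in proper_restriction_semigroup) sigma_compatible:
  assumes "(s, t) \<in> sigma_rel S" "s \<in> carrier S" "t \<in> carrier S"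
  shows "s \<cdot> star S t = t \<cdot> star S s"
proof (rule proper)
  show "star S (s \<cdot> star S t) = star S (t \<cdot> star S s)"
    using assms by (simp add: star_m_proj star_proj star_comm)
  show "(s \<cdot> star S t, t \<cdot> star S s) \<in> sigma_rel S"
    using assms by (rule_tac sigma_m[OF _ sigma_proj[OF star_proj star_proj]])
qed

lemma restriction_semigroup_PT: "restriction_semigroup (PT X)"
proof
  show "carrier (PT X) \<noteq> {}"
    by (auto simp: PT_def intro!: exI[of _ Map.empty])
next
  fix f g assume fg: "f \<in> carrier (PT X)" "g \<in> carrier (PT X)"
  then have f: "openin X (dom f)" "continuous_map (subtopology X (dom f)) X (\<lambda>x. the (f x))"
    and g: "openin X (dom g)" "continuous_map (subtopology X (dom g)) X (\<lambda>x. the (g x))"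
    by (simp_all add: PT_def)
  have "dom g \<subseteq> topspace X"
    using g(1) by (rule openin_subset)
  then have d: "dom (f \<circ>\<^sub>m g) = {x \<in> topspace (subtopology X (dom g)). the (g x) \<in> dom f}"
    by (auto simp: map_comp_def split: option.splits)
  have "openin (subtopology X (dom g)) (dom (f \<circ>\<^sub>m g))"
    unfolding d by (rule openin_continuous_map_preimage[OF g(2) f(1)])
  then have o: "openin X (dom (f \<circ>\<^sub>m g))"
    by (rule openin_trans_full[OF _ g(1)])
  have sub: "dom (f \<circ>\<^sub>m g) \<subseteq> dom g"
    by (auto simp: map_comp_def split: option.splits)
  have "continuous_map (subtopology X (dom (f \<circ>\<^sub>m g))) (subtopology X (dom f)) (\<lambda>x. the (g x))"
    unfolding continuous_map_in_subtopology
    using continuous_map_from_subtopology_mono[OF g(2) sub] d by auto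
  then have "continuous_map (subtopology X (dom (f \<circ>\<^sub>m g))) X ((\<lambda>x. the (f x)) \<circ> (\<lambda>x. the (g x)))"
    by (rule continuous_map_compose[OF _ f(2)])
  then have "continuous_map (subtopology X (dom (f \<circ>\<^sub>m g))) X (\<lambda>x. the ((f \<circ>\<^sub>m g) x))"
    by (rule continuous_map_eq) (auto simp: map_comp_def split: option.splits)
  with o show "f \<cdot>\<^bsub>PT X\<^esub> g \<in> carrier (PT X)" by (simp add: PT_def)
next
  fix f assume f: "f \<in> carrier (PT X)"
  have "continuous_map (subtopology X (dom f)) X (\<lambda>x. the ((Some |` dom f) x))"
    by (rule continuous_map_eq[OF continuous_map_from_subtopology[OF continuous_map_id]])
      (simp add: restrict_map_def)
  then show "star (PT X) f \<in> carrier (PT X)"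
    using f by (auto simp: PT_def dom_restrict)
qed (auto simp: PT_def map_comp_def restrict_map_def fun_eq_iff domIff split: option.splits)

locale proper_action = proper_restriction_semigroup S
  for S :: "('a, 'b) rsemigroup_scheme" (structure) +
  fixes X :: "'x topology" and \<theta> :: "'a \<Rightarrow> 'x \<rightharpoonup> 'x"
  assumes action: "rs_action S X \<theta>"
begin

lemma act_PT: "s \<in> carrier S \<Longrightarrow> \<theta> s \<in> carrier (PT X)"
  using action by (auto simp: rs_action_def rs_hom_def)

lemma act_open: "s \<in> carrier S \<Longrightarrow> openin X (dom (\<theta> s))"
  using act_PT by (force simp: PT_def)

lemma act_m: "s \<in> carrier S \<Longrightarrow> t \<in> carrier S \<Longrightarrow> \<theta> (s \<cdot> t) = \<theta> s \<circ>\<^sub>m \<theta> t"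
  using action by (auto simp: rs_action_def rs_hom_def PT_def)

lemma act_star: "s \<in> carrier S \<Longrightarrow> \<theta> (star S s) = Some |` dom (\<theta> s)"
  using action by (auto simp: rs_action_def rs_hom_def PT_def)

lemma dom_act_star: "s \<in> carrier S \<Longrightarrow> dom (\<theta> (star S s)) = dom (\<theta> s)"
  by (simp add: act_star dom_restrict)

lemma act_proj: "e \<in> projections S \<Longrightarrow> x \<in> dom (\<theta> e) \<Longrightarrow> \<theta> e x = Some x"
  using act_star[OF proj_closed] star_of_proj by (metis restrict_in)

lemma act_cover: "x \<in> topspace X \<Longrightarrow> \<exists>e\<in>projections S. x \<in> dom (\<theta> e)"
  using action unfolding rs_action_def by blast

lemma act_in_topspace:
  assumes "s \<in> carrier S" "x \<in> dom (\<theta> s)"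
  shows "the (\<theta> s x) \<in> topspace X"
proof -
  have "continuous_map (subtopology X (dom (\<theta> s))) X (\<lambda>x. the (\<theta> s x))"
    using act_PT[OF assms(1)] by (simp add: PT_def)
  moreover have "x \<in> topspace (subtopology X (dom (\<theta> s)))"
    using assms act_open[OF assms(1)] openin_subset by fastforce
  ultimately show ?thesis by (auto simp: continuous_map_def)
qed

lemma act_le:
  assumes "u \<in> carrier S" "s \<in> carrier S" "natural_le S u s" "x \<in> dom (\<theta> u)"
  shows "\<theta> u x = \<theta> s x"
proof -
  have "\<theta> u = \<theta> s \<circ>\<^sub>m \<theta> (star S u)"
    using assms act_m star_closed by (metis natural_le_def)
  then have "\<theta> u x = (\<theta> s \<circ>\<^sub>m (Some |` dom (\<theta> u))) x"
    unfolding act_star[OF assms(1)] by (rule fun_cong)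
  then show ?thesis
    using assms(4) by (simp add: map_comp_def)
qed

lemma act_m_star:
  assumes "s \<in> carrier S" "t \<in> carrier S"
  shows "\<theta> (s \<cdot> star S t) x = (if x \<in> dom (\<theta> t) then \<theta> s x else None)"
  using assms by (simp add: act_m star_closed act_star map_comp_def restrict_map_def)

lemma act_sigma:
  assumes "(s, t) \<in> sigma_rel S" "s \<in> carrier S" "t \<in> carrier S" "x \<in> dom (\<theta> s)" "x \<in> dom (\<theta> t)"
  shows "\<theta> s x = \<theta> t x"
proof -
  have "\<theta> s x = \<theta> (s \<cdot> star S t) x"
    using act_m_star[OF assms(2,3)] assms(5) by simp
  also have "\<dots> = \<theta> (t \<cdot> star S s) x"
    by (simp only: sigma_compatible[OF assms(1-3)])
  also have "\<dots> = \<theta> t x"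
    using act_m_star[OF assms(3,2)] assms(4) by simp
  finally show ?thesis .
qed

theorem induced_partial_action_eq:
  assumes "u \<in> carrier S" "sigma_class S u = t" "x \<in> dom (\<theta> u)"
  shows "induced_partial_action S \<theta> t x = \<theta> u x"
proof -
  let ?P = "\<lambda>u. u \<in> carrier S \<and> sigma_class S u = t \<and> x \<in> dom (\<theta> u)"
  have P: "?P (SOME u. ?P u)" using assms by (intro someI[of ?P u]) blast
  then have "(SOME u. ?P u, u) \<in> sigma_rel S"
    using assms by (metis sigma_class_eq_iff)
  then show ?thesis
    using act_sigma[of "SOME u. ?P u" u x] P assms unfolding induced_partial_action_def
    by (subst if_P) blast+
qed

theorem dom_induced_partial_action:
  "dom (induced_partial_action S \<theta> t) = (\<Union>s\<in>{s \<in> carrier S. sigma_class S s = t}. dom (\<theta> s))"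
proof (rule equalityI; rule subsetI)
  fix x assume "x \<in> dom (induced_partial_action S \<theta> t)"
  then show "x \<in> (\<Union>s\<in>{s \<in> carrier S. sigma_class S s = t}. dom (\<theta> s))"
    by (rule contrapos_pp) (simp add: induced_partial_action_def domIff)
next
  fix x assume "x \<in> (\<Union>s\<in>{s \<in> carrier S. sigma_class S s = t}. dom (\<theta> s))"
  then obtain s where "s \<in> carrier S" "sigma_class S s = t" "x \<in> dom (\<theta> s)"
    by blast
  then show "x \<in> dom (induced_partial_action S \<theta> t)"
    using induced_partial_action_eq[of s t x] by (simp add: domIff)
qed

lemma induced_partial_action_PT: "induced_partial_action S \<theta> t \<in> carrier (PT X)"
proof -
  let ?f = "induced_partial_action S \<theta> t" and ?I = "{s \<in> carrier S. sigma_class S s = t}"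
  have o: "openin X (dom ?f)"
    unfolding dom_induced_partial_action by (rule openin_Union) (auto simp: act_open)
  have "continuous_map (subtopology X (dom ?f)) X (\<lambda>x. the (?f x))"
  proof (rule pasting_lemma[where I = ?I and T = "\<lambda>s. dom (\<theta> s)" and f = "\<lambda>s x. the (\<theta> s x)"])
    fix s assume s: "s \<in> ?I"
    then have sub: "dom (\<theta> s) \<subseteq> dom ?f"
      unfolding dom_induced_partial_action by blast
    show "openin (subtopology X (dom ?f)) (dom (\<theta> s))"
      using s act_open sub by (simp add: openin_open_subtopology[OF o])
    show "continuous_map (subtopology (subtopology X (dom ?f)) (dom (\<theta> s))) X (\<lambda>x. the (\<theta> s x))"
      using s act_PT[of s] sub by (simp add: PT_def subtopology_subtopology Int_absorb1)
  next
    fix i j x assume "i \<in> ?I" "j \<in> ?I" "x \<in> topspace (subtopology X (dom ?f)) \<inter> dom (\<theta> i) \<inter> dom (\<theta> j)"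
    then show "the (\<theta> i x) = the (\<theta> j x)"
      using induced_partial_action_eq[of i t x] induced_partial_action_eq[of j t x] by simp
  next
    fix x assume "x \<in> topspace (subtopology X (dom ?f))"
    then have "x \<in> dom ?f" by simp
    then obtain s where "s \<in> ?I" "x \<in> dom (\<theta> s)"
      unfolding dom_induced_partial_action by blast
    then show "\<exists>j. j \<in> ?I \<and> x \<in> dom (\<theta> j) \<and> the (?f x) = the (\<theta> j x)"
      using induced_partial_action_eq[of s t x] by (intro exI[of _ s]) simp
  qed
  with o show ?thesis by (simp add: PT_def)
qed

theorem partial_action_induced_partial_action:
  "partial_action (sigma_quotient S) X (induced_partial_action S \<theta>)"
  unfolding partial_action_def
proof (intro conjI ballI)
  let ?f = "induced_partial_action S \<theta>"
  show "?f \<in> carrier (sigma_quotient S) \<rightarrow> carrier (PT X)"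
    using induced_partial_action_PT by blast
  show "?f \<one>\<^bsub>sigma_quotient S\<^esub> = Some |` topspace X"
  proof
    fix x show "?f \<one>\<^bsub>sigma_quotient S\<^esub> x = (Some |` topspace X) x"
    proof (cases "x \<in> topspace X")
      case True
      then obtain e where "e \<in> projections S" "x \<in> dom (\<theta> e)" using act_cover by blast
      then show ?thesis
        using induced_partial_action_eq[of e] True
        by (simp add: sigma_quotient_one proj_closed act_proj)
    next
      case False
      then have "x \<notin> dom (?f \<one>\<^bsub>sigma_quotient S\<^esub>)"
        unfolding dom_induced_partial_action by (auto dest!: act_open openin_subset iff del: domIff)
      then show ?thesis using False by (simp add: domIff)
    qed
  qed
  fix s t assume st: "s \<in> carrier (sigma_quotient S)" "t \<in> carrier (sigma_quotient S)"
  show "?f s \<circ>\<^sub>m ?f t \<subseteq>\<^sub>m ?f (s \<otimes>\<^bsub>sigma_quotient S\<^esub> t)"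
    unfolding map_le_def
  proof
    fix x assume "x \<in> dom (?f s \<circ>\<^sub>m ?f t)"
    then obtain z where "(?f s \<circ>\<^sub>m ?f t) x = Some z" by (rule domD[THEN exE])
    then obtain y where y: "?f t x = Some y" "?f s y = Some z"
      unfolding map_comp_Some_iff by (elim exE conjE)
    have "x \<in> dom (?f t)" "y \<in> dom (?f s)"
      by (simp_all add: domIff y)
    then obtain v where v: "v \<in> carrier S" "sigma_class S v = t" "x \<in> dom (\<theta> v)"
      using dom_induced_partial_action[of t] by blast
    obtain u where u: "u \<in> carrier S" "sigma_class S u = s" "y \<in> dom (\<theta> u)"
      using \<open>y \<in> dom (?f s)\<close> dom_induced_partial_action[of s] by blast
    have vx: "\<theta> v x = Some y" using induced_partial_action_eq[OF v] y by simp
    have uy: "?f s y = \<theta> u y" using induced_partial_action_eq[OF u] .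
    have uv: "\<theta> (u \<cdot> v) x = \<theta> u y" using u v vx by (simp add: act_m)
    have "?f (s \<otimes>\<^bsub>sigma_quotient S\<^esub> t) x = \<theta> (u \<cdot> v) x"
      using u v uv by (intro induced_partial_action_eq) (auto simp: m_closed sigma_quotient_mult)
    then show "(?f s \<circ>\<^sub>m ?f t) x = ?f (s \<otimes>\<^bsub>sigma_quotient S\<^esub> t) x"
      using uv uy y by simp
  qed
qed

lemma germ_domain_iff: "(s, x) \<in> germ_domain S \<theta> \<longleftrightarrow> s \<in> carrier S \<and> x \<in> dom (\<theta> s)"
  by (auto simp: germ_domain_def dom_act_star iff del: domIff)

lemma germ_rel_iff: "((s, x), (t, y)) \<in> germ_rel S \<theta> \<longleftrightarrow>
    s \<in> carrier S \<and> t \<in> carrier S \<and> x = y \<and> x \<in> dom (\<theta> s) \<and> x \<in> dom (\<theta> t) \<and>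
    (\<exists>u\<in>carrier S. natural_le S u s \<and> natural_le S u t \<and> x \<in> dom (\<theta> u))"
  by (auto simp: germ_rel_def germ_domain_iff dom_act_star iff del: domIff)

theorem equiv_germ_rel: "equiv (germ_domain S \<theta>) (germ_rel S \<theta>)"
proof (rule equivI)
  show "germ_rel S \<theta> \<subseteq> germ_domain S \<theta> \<times> germ_domain S \<theta>"
    by (auto simp: germ_rel_def)
  show "refl_on (germ_domain S \<theta>) (germ_rel S \<theta>)"
  proof (rule refl_onI, clarify)
    fix s x assume "(s, x) \<in> germ_domain S \<theta>"
    then show "((s, x), (s, x)) \<in> germ_rel S \<theta>"
      by (auto simp: germ_domain_iff germ_rel_iff natural_le_def m_star intro!: bexI[of _ s]
          iff del: domIff)
  qed
  show "sym (germ_rel S \<theta>)"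
    by (rule symI) (auto simp: germ_rel_def)
  show "trans (germ_rel S \<theta>)"
  proof (rule transI, clarify)
    fix s x t y w z
    assume 1: "((s, x), (t, y)) \<in> germ_rel S \<theta>" and 2: "((t, y), (w, z)) \<in> germ_rel S \<theta>"
    obtain u where u: "u \<in> carrier S" "natural_le S u s" "natural_le S u t" "x \<in> dom (\<theta> u)"
      using 1 by (auto simp: germ_rel_iff)
    obtain v where v: "v \<in> carrier S" "natural_le S v t" "natural_le S v w" "x \<in> dom (\<theta> v)"
      using 1 2 by (auto simp: germ_rel_iff)
    have c: "s \<in> carrier S" "t \<in> carrier S" "w \<in> carrier S"
      using 1 2 by (auto simp: germ_rel_iff)
    have "t \<cdot> star S u \<cdot> star S v = t \<cdot> star S v \<cdot> star S u"
      using u(1) v(1) c(2) by (simp add: m_assoc star_closed star_comm)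
    moreover have "t \<cdot> star S u = u"
      using u(3) unfolding natural_le_def by (rule sym)
    moreover have "t \<cdot> star S v = v"
      using v(2) unfolding natural_le_def by (rule sym)
    ultimately have eq: "u \<cdot> star S v = v \<cdot> star S u" by simp
    have p: "u \<cdot> star S v \<in> carrier S"
      using u v by (simp add: m_closed star_closed)
    have "natural_le S (u \<cdot> star S v) s"
      by (rule natural_le_trans[OF p u(1) c(1) natural_leI[OF u(1) star_proj[OF v(1)]] u(2)])
    moreover have "natural_le S (u \<cdot> star S v) w"
      using natural_le_trans[OF p[unfolded eq] v(1) c(3) natural_leI[OF v(1) star_proj[OF u(1)]] v(3)]
      unfolding eq .
    moreover have "x \<in> dom (\<theta> (u \<cdot> star S v))"
      using u(1,4) v(1,4) by (auto simp: dom_def act_m_star)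
    ultimately show "((s, x), (w, z)) \<in> germ_rel S \<theta>"
      using 1 2 p unfolding germ_rel_iff by blast
  qed
qed

lemma germ_eq_iff:
  assumes "s \<in> carrier S" "x \<in> dom (\<theta> s)" "t \<in> carrier S" "y \<in> dom (\<theta> t)"
  shows "germ S \<theta> s x = germ S \<theta> t y \<longleftrightarrow>
    x = y \<and> (\<exists>u\<in>carrier S. natural_le S u s \<and> natural_le S u t \<and> x \<in> dom (\<theta> u))"
proof -
  have "germ S \<theta> s x = germ S \<theta> t y \<longleftrightarrow> ((s, x), (t, y)) \<in> germ_rel S \<theta>"
    unfolding germ_def using assms
    by (intro eq_equiv_class_iff[OF equiv_germ_rel]) (auto simp: germ_domain_iff)
  then show ?thesis using assms by (auto simp: germ_rel_iff)
qed

lemma germ_proj_eq: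
  assumes "e \<in> projections S" "f \<in> projections S" "x \<in> dom (\<theta> e)" "x \<in> dom (\<theta> f)"
  shows "germ S \<theta> e x = germ S \<theta> f x"
proof -
  have c: "e \<in> carrier S" "f \<in> carrier S" using assms proj_closed by auto
  have "natural_le S (e \<cdot> f) e" "natural_le S (e \<cdot> f) f"
    using natural_leI[OF c(1) assms(2)] natural_leI[OF c(2) assms(1)] proj_comm[OF assms(1,2)]
    by auto
  moreover have "x \<in> dom (\<theta> (e \<cdot> f))"
    using assms c by (simp add: act_m domIff act_proj)
  ultimately show ?thesis
    unfolding germ_eq_iff[OF c(1) assms(3) c(2) assms(4)] using m_closed[OF c] by blast
qed

lemma germ_eq_le:
  assumes "u \<in> carrier S" "s \<in> carrier S" "natural_le S u s" "x \<in> dom (\<theta> u)"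
  shows "germ S \<theta> u x = germ S \<theta> s x"
proof -
  have s: "x \<in> dom (\<theta> s)" using act_le[OF assms] assms(4) by (simp add: domIff)
  have "natural_le S u u" using assms(1) by (simp add: natural_le_def m_star)
  then show ?thesis
    unfolding germ_eq_iff[OF assms(1,4,2) s] using assms by blast
qed

lemma germ_eqD:
  assumes "s \<in> carrier S" "x \<in> dom (\<theta> s)" "t \<in> carrier S" "y \<in> dom (\<theta> t)"
    "germ S \<theta> s x = germ S \<theta> t y"
  shows "x = y" "\<theta> s x = \<theta> t y"
proof -
  have *: "x = y \<and> (\<exists>u\<in>carrier S. natural_le S u s \<and> natural_le S u t \<and> x \<in> dom (\<theta> u))"
    using assms(5) unfolding germ_eq_iff[OF assms(1-4)] .
  then show "x = y" by simp
  obtain u where u: "u \<in> carrier S" "natural_le S u s" "natural_le S u t" "x \<in> dom (\<theta> u)"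
    using * by blast
  show "\<theta> s x = \<theta> t y"
    using act_le[OF u(1) assms(1) u(2,4)] act_le[OF u(1) assms(3) u(3,4)] \<open>x = y\<close> by simp
qed

theorem germ_cdom_germ:
  assumes "s \<in> carrier S" "x \<in> dom (\<theta> s)"
  shows "germ_cdom S \<theta> (germ S \<theta> s x) = germ S \<theta> (star S s) x"
  unfolding germ_cdom_def
proof (rule the_equality)
  show "\<exists>(t, y)\<in>germ_domain S \<theta>.
     germ S \<theta> s x = germ S \<theta> t y \<and> germ S \<theta> (star S s) x = germ S \<theta> (star S t) y"
    using assms by (intro bexI[of _ "(s, x)"]) (auto simp: germ_domain_iff)
next
  fix h assume "\<exists>(t, y)\<in>germ_domain S \<theta>.
     germ S \<theta> s x = germ S \<theta> t y \<and> h = germ S \<theta> (star S t) y"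
  then obtain t y where t: "t \<in> carrier S" "y \<in> dom (\<theta> t)"
      "germ S \<theta> s x = germ S \<theta> t y" "h = germ S \<theta> (star S t) y"
    by (auto simp: germ_domain_iff iff del: domIff)
  then show "h = germ S \<theta> (star S s) x"
    using germ_eqD[OF assms t(1-3)] assms germ_proj_eq[of "star S t" "star S s" y]
    by (simp add: star_proj dom_act_star)
qed

theorem germ_cran_germ:
  assumes "s \<in> carrier S" "x \<in> dom (\<theta> s)" "e \<in> projections S" "the (\<theta> s x) \<in> dom (\<theta> e)"
  shows "germ_cran S \<theta> (germ S \<theta> s x) = germ S \<theta> e (the (\<theta> s x))"
  unfolding germ_cran_def
proof (rule the_equality)
  show "\<exists>(t, y)\<in>germ_domain S \<theta>. \<exists>f\<in>projections S. germ S \<theta> s x = germ S \<theta> t y \<and>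
     the (\<theta> t y) \<in> dom (\<theta> f) \<and> germ S \<theta> e (the (\<theta> s x)) = germ S \<theta> f (the (\<theta> t y))"
    using assms by (intro bexI[of _ "(s, x)"]) (auto simp: germ_domain_iff)
next
  fix h assume "\<exists>(t, y)\<in>germ_domain S \<theta>. \<exists>f\<in>projections S. germ S \<theta> s x = germ S \<theta> t y \<and>
     the (\<theta> t y) \<in> dom (\<theta> f) \<and> h = germ S \<theta> f (the (\<theta> t y))"
  then obtain t y f where t: "t \<in> carrier S" "y \<in> dom (\<theta> t)" "germ S \<theta> s x = germ S \<theta> t y"
      "f \<in> projections S" "the (\<theta> t y) \<in> dom (\<theta> f)" "h = germ S \<theta> f (the (\<theta> t y))"
    by (auto simp: germ_domain_iff iff del: domIff)
  have "the (\<theta> t y) = the (\<theta> s x)"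
    using germ_eqD(2)[OF assms(1,2) t(1-3)] by simp
  then show "h = germ S \<theta> e (the (\<theta> s x))"
    using germ_proj_eq[OF t(4) assms(3)] t(5,6) assms(4) by simp
qed

theorem germ_mult_germ:
  assumes "t \<in> carrier S" "y \<in> dom (\<theta> t)" "s \<in> carrier S" "the (\<theta> t y) \<in> dom (\<theta> s)"
  shows "germ_mult S \<theta> (germ S \<theta> s (the (\<theta> t y))) (germ S \<theta> t y) = germ S \<theta> (s \<cdot> t) y"
  unfolding germ_mult_def
proof (rule the_equality)
  show "\<exists>s'. \<exists>(t', y')\<in>germ_domain S \<theta>. (s', the (\<theta> t' y')) \<in> germ_domain S \<theta> \<and>
     germ S \<theta> s (the (\<theta> t y)) = germ S \<theta> s' (the (\<theta> t' y')) \<and>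
     germ S \<theta> t y = germ S \<theta> t' y' \<and> germ S \<theta> (s \<cdot> t) y = germ S \<theta> (s' \<cdot> t') y'"
    using assms by (intro exI[of _ s] bexI[of _ "(t, y)"]) (auto simp: germ_domain_iff)
next
  fix k assume "\<exists>s'. \<exists>(t', y')\<in>germ_domain S \<theta>. (s', the (\<theta> t' y')) \<in> germ_domain S \<theta> \<and>
     germ S \<theta> s (the (\<theta> t y)) = germ S \<theta> s' (the (\<theta> t' y')) \<and>
     germ S \<theta> t y = germ S \<theta> t' y' \<and> k = germ S \<theta> (s' \<cdot> t') y'"
  then obtain s' t' y' where c: "s' \<in> carrier S" "t' \<in> carrier S"
    and y': "y' \<in> dom (\<theta> t')" "the (\<theta> t' y') \<in> dom (\<theta> s')"
    and eq: "germ S \<theta> s (the (\<theta> t y)) = germ S \<theta> s' (the (\<theta> t' y'))"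
      "germ S \<theta> t y = germ S \<theta> t' y'" and k: "k = germ S \<theta> (s' \<cdot> t') y'"
    by (auto simp: germ_domain_iff iff del: domIff)
  obtain u where u: "u \<in> carrier S" "natural_le S u s" "natural_le S u s'" "the (\<theta> t y) \<in> dom (\<theta> u)"
    using eq(1) germ_eq_iff[OF assms(3,4) c(1) y'(2)] by blast
  obtain v where v: "v \<in> carrier S" "natural_le S v t" "natural_le S v t'" "y \<in> dom (\<theta> v)" "y = y'"
    using eq(2) germ_eq_iff[OF assms(1,2) c(2) y'(1)] by blast
  have "\<theta> v y = \<theta> t y"
    using act_le[OF v(1) assms(1) v(2,4)] .
  then have "y \<in> dom (\<theta> (u \<cdot> v))"
    using u(1,4) v(1) assms(2) by (auto simp: act_m)
  then have "germ S \<theta> (u \<cdot> v) y = germ S \<theta> (s \<cdot> t) y" "germ S \<theta> (u \<cdot> v) y = germ S \<theta> (s' \<cdot> t') y"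
    using germ_eq_le[OF m_closed[OF u(1) v(1)]] u v c assms(1,3)
    by (simp_all add: natural_le_mult m_closed)
  then show "k = germ S \<theta> (s \<cdot> t) y" using k v(5) by simp
qed

theorem openin_germ_topology:
  "openin (germ_topology S X \<theta>) = arbitrary union_of (\<lambda>B. \<exists>s\<in>carrier S. \<exists>U.
     openin X U \<and> U \<subseteq> dom (\<theta> (star S s)) \<and> B = germ_basic_open S \<theta> s U)"
proof -
  let ?P = "\<lambda>B. \<exists>s\<in>carrier S. \<exists>U.
     openin X U \<and> U \<subseteq> dom (\<theta> (star S s)) \<and> B = germ_basic_open S \<theta> s U"
  have "(arbitrary union_of ?P) (B \<inter> C)" if BC: "?P B" "?P C" for B C
  proof -
    obtain s U where s: "s \<in> carrier S" "openin X U" "U \<subseteq> dom (\<theta> s)" "B = germ S \<theta> s ` U"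
      using BC(1) by (auto simp: germ_basic_open_def dom_act_star)
    obtain t V where t: "t \<in> carrier S" "openin X V" "V \<subseteq> dom (\<theta> t)" "C = germ S \<theta> t ` V"
      using BC(2) by (auto simp: germ_basic_open_def dom_act_star)
    have "\<exists>D. ?P D \<and> g \<in> D \<and> D \<subseteq> B \<inter> C" if g: "g \<in> B \<inter> C" for g
    proof -
      obtain x where x: "x \<in> U" "g = germ S \<theta> s x" using g s by blast
      obtain y where y: "y \<in> V" "g = germ S \<theta> t y" using g t by blast
      have xs: "x \<in> dom (\<theta> s)" and yt: "y \<in> dom (\<theta> t)" using x y s t by auto
      have "germ S \<theta> s x = germ S \<theta> t y" using x y by simp
      then have "x = y \<and> (\<exists>u\<in>carrier S. natural_le S u s \<and> natural_le S u t \<and> x \<in> dom (\<theta> u))"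
        unfolding germ_eq_iff[OF s(1) xs t(1) yt] .
      then obtain u where u: "u \<in> carrier S" "natural_le S u s" "natural_le S u t"
          "x \<in> dom (\<theta> u)" "x = y"
        by blast
      let ?W = "U \<inter> V \<inter> dom (\<theta> u)"
      have W: "germ S \<theta> u z = germ S \<theta> s z" "germ S \<theta> u z = germ S \<theta> t z" if "z \<in> ?W" for z
        using germ_eq_le[OF u(1) s(1) u(2)] germ_eq_le[OF u(1) t(1) u(3)] that by simp_all
      have "germ S \<theta> u ` ?W = germ S \<theta> s ` ?W" "germ S \<theta> u ` ?W = germ S \<theta> t ` ?W"
        using W by (auto intro!: image_cong)
      moreover have "germ S \<theta> s ` ?W \<subseteq> B" "germ S \<theta> t ` ?W \<subseteq> C"
        unfolding s(4) t(4) by (rule image_mono, simp add: le_infI1)+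
      ultimately have "germ_basic_open S \<theta> u ?W \<subseteq> B \<inter> C"
        unfolding germ_basic_open_def by (intro Int_greatest) simp_all
      moreover have "x \<in> ?W" using x y u by simp
      then have "g \<in> germ_basic_open S \<theta> u ?W"
        unfolding germ_basic_open_def x(2) W(1)[OF \<open>x \<in> ?W\<close>, symmetric] by (rule imageI)
      moreover have "?P (germ_basic_open S \<theta> u ?W)"
      proof (intro bexI[of _ u] exI[of _ ?W] conjI refl)
        show "openin X ?W"
          using s(2) t(2) act_open[OF u(1)] by (intro openin_Int)
        show "?W \<subseteq> dom (\<theta> (star S u))"
          unfolding dom_act_star[OF u(1)] by (rule Int_lower2)
      qed (rule u(1))
      ultimately show ?thesis by (intro exI[of _ "germ_basic_open S \<theta> u ?W"] conjI)
    qed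
    then have "B \<inter> C \<subseteq> \<Union>{D. ?P D \<and> D \<subseteq> B \<inter> C}" by fast
    then have "\<Union>{D. ?P D \<and> D \<subseteq> B \<inter> C} = B \<inter> C"
      by (intro equalityI Sup_least) auto
    then show ?thesis
      unfolding union_of_def arbitrary_def
      by (intro exI[of _ "{D. ?P D \<and> D \<subseteq> B \<inter> C}"] conjI TrueI) auto
  qed
  then have "istopology (arbitrary union_of ?P)"
    unfolding istopology_base_eq by (intro allI impI) (elim conjE)
  then show ?thesis by (simp add: germ_topology_def)
qed

end

end

theory Submission
  imports Defs
begin

text \<open>
  Two elements \<open>s\<close>, \<open>t\<close> of a proper restriction semigroup that are \<open>\<sigma>\<close>-related have the common
  lower bound \<open>s t\<^sup>* = t s\<^sup>*\<close>, whose domain is \<open>dom \<theta>\<^sub>s \<inter> dom \<theta>\<^sub>t\<close>.  Hence a germ \<open>[s, x]\<close> is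
  determined by \<open>x\<close> and the \<open>\<sigma>\<close>-class of \<open>s\<close>, and \<open>([s]\<^sub>\<sigma>, x) \<mapsto> [s, x]\<close> is a bijection of the
  arrows.  It carries the open sets \<open>{[s]\<^sub>\<sigma>} \<times> U\<close> to the basic open sets \<open>(s, U)\<close> and preserves
  the operations, so that the axioms of a topological category need only be verified for the
  transformation category and can then be transported.
\<close>

section \<open>Transport of topological categories\<close>

text \<open>\<open>F\<close> is a bijection of the arrows compatible with the structure maps, so
  each axiom for \<open>D\<close> follows by pulling arrows back to \<open>C\<close>. The equations
  for units and for \<open>topspace\<close> are assumed separately because \<open>D\<close> is not
  yet known to be a category: \<open>is_functor\<close> alone gives only that \<open>F\<close> sends
  units to units.\<close>

lemma topological_category_transport:
  assumes C: "topological_category C"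
    and F: "is_functor C D F"
    and homeo: "homeomorphic_map (arrow_topology C) (arrow_topology D) F"
    and units: "F ` units C = units D"
    and topspace: "topspace (arrow_topology D) = arrows D"
  shows "topological_category D"
proof -
  interpret C: topological_category C by (rule C)
  have cdom: "cdom D (F x) = F (cdom C x)" and cran: "cran D (F x) = F (cran C x)"
    if "x \<in> arrows C" for x
    using F that by (simp_all add: is_functor_def)
  have mult: "catmult D (F x) (F y) = F (catmult C x y)" if "(x, y) \<in> composable C" for x y
    using F that by (fastforce simp: is_functor_def)
  have FC: "F ` arrows C = arrows D" and inj: "inj_on F (arrows C)"
    using homeo topspace
    by (simp_all add: homeomorphic_eq_everything_map C.topspace_arrow_topology)
  have F_in: "F x \<in> arrows D" if "x \<in> arrows C" for x
    using that FC by blast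
  have arrowE: "\<exists>x\<in>arrows C. a = F x" if "a \<in> arrows D" for a
    using that FC by blast
  have unitE: "\<exists>x\<in>units C. a = F x" if "a \<in> units D" for a
    using that units by blast
  have cc: "cdom C x \<in> arrows C" "cran C x \<in> arrows C" if "x \<in> arrows C" for x
    using that C.cdom_closed C.cran_closed C.units_subset by auto
  \<comment> \<open>Composable pairs lift: \<open>cran D b = cdom D a\<close> becomes an equation
    between values of \<open>F\<close> at arrows of \<open>C\<close>, and \<open>F\<close> is
    injective there.\<close>
  have compE: "\<exists>x y. (x, y) \<in> composable C \<and> a = F x \<and> b = F y"
    if ab: "(a, b) \<in> composable D" for a b
  proof -
    have "a \<in> arrows D" "b \<in> arrows D" "cran D b = cdom D a"
      using ab by (simp_all add: composable_def)
    then obtain x y where "x \<in> arrows C" "y \<in> arrows C" "a = F x" "b = F y"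
        "F (cran C y) = F (cdom C x)"
      using arrowE cdom cran by metis
    then have "(x, y) \<in> composable C"
      using inj_onD[OF inj] cc by (simp add: composable_def)
    then show ?thesis using \<open>a = F x\<close> \<open>b = F y\<close> by blast
  qed
  have compI: "(F x, F y) \<in> composable D" if "(x, y) \<in> composable C" for x y
    using that by (simp add: composable_def cdom cran F_in)
  obtain G where G: "homeomorphic_maps (arrow_topology C) (arrow_topology D) F G"
    using homeo homeomorphic_map_maps by blast
  have GF: "G (F x) = x" if "x \<in> arrows C" for x
    using that G by (simp add: homeomorphic_maps_def C.topspace_arrow_topology)
  have G_in: "G a \<in> arrows C" and FG: "F (G a) = a" if "a \<in> arrows D" for a
    using arrowE[OF that] GF by auto
  have F_cont: "continuous_map (arrow_topology C) (arrow_topology D) F"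
    and G_cont: "continuous_map (arrow_topology D) (arrow_topology C) G"
    using G by (simp_all add: homeomorphic_maps_def)
  show ?thesis
  proof
    show "units D \<subseteq> arrows D"
      using C.units_subset FC units by blast
    show "cdom D a \<in> units D" "cran D a \<in> units D" "catmult D a (cdom D a) = a"
      "catmult D (cran D a) a = a" if a: "a \<in> arrows D" for a
    proof -
      obtain x where x: "x \<in> arrows C" "a = F x" using arrowE[OF a] by blast
      show "cdom D a \<in> units D" "cran D a \<in> units D"
        using x C.cdom_closed[OF x(1)] C.cran_closed[OF x(1)] units by (auto simp: cdom cran)
      have "(x, cdom C x) \<in> composable C" "(cran C x, x) \<in> composable C"
        using x cc C.cdom_closed C.cran_closed C.cdom_unit C.cran_unit
        by (simp_all add: composable_def)
      then show "catmult D a (cdom D a) = a" "catmult D (cran D a) a = a"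
        using x by (simp_all add: cdom cran mult C.catmult_cdom C.cran_catmult_self)
    qed
    show "cdom D a = a" "cran D a = a" if a: "a \<in> units D" for a
    proof -
      obtain x where "x \<in> units C" "a = F x" using unitE[OF a] by blast
      then show "cdom D a = a" "cran D a = a"
        using C.units_subset by (auto simp: cdom cran C.cdom_unit C.cran_unit subset_iff)
    qed
    show "catmult D a b \<in> arrows D" "cdom D (catmult D a b) = cdom D b"
      "cran D (catmult D a b) = cran D a" if ab: "(a, b) \<in> composable D" for a b
    proof -
      obtain x y where xy: "(x, y) \<in> composable C" "a = F x" "b = F y"
        using compE[OF ab] by blast
      moreover have "x \<in> arrows C" "y \<in> arrows C" "catmult C x y \<in> arrows C"
        using xy(1) C.catmult_closed by (auto simp: composable_def)
      ultimately show "catmult D a b \<in> arrows D" "cdom D (catmult D a b) = cdom D b"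
        "cran D (catmult D a b) = cran D a"
        by (simp_all add: mult cdom cran F_in C.cdom_catmult C.cran_catmult)
    qed
    show "catmult D (catmult D a b) c = catmult D a (catmult D b c)"
      if ab: "(a, b) \<in> composable D" and bc: "(b, c) \<in> composable D" for a b c
    proof -
      obtain x y where xy: "(x, y) \<in> composable C" "a = F x" "b = F y"
        using compE[OF ab] by blast
      obtain y' z where yz: "(y', z) \<in> composable C" "b = F y'" "c = F z"
        using compE[OF bc] by blast
      \<comment> \<open>The lifts of the two composable pairs share the middle arrow
        \<open>b\<close>, so injectivity glues them to a composable triple.\<close>
      have "y' = y"
        using xy yz inj_onD[OF inj, of y' y] by (auto simp: composable_def)
      then have yz': "(y, z) \<in> composable C" using yz by simp
      have "(catmult C x y, z) \<in> composable C" "(x, catmult C y z) \<in> composable C"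
        using C.catmult_closed[OF xy(1)] C.catmult_closed[OF yz'] C.cdom_catmult[OF xy(1)]
          C.cran_catmult[OF yz'] xy(1) yz'
        by (simp_all add: composable_def)
      then show ?thesis
        using xy yz yz' by (simp add: mult C.catmult_assoc)
    qed
    show "topspace (arrow_topology D) = arrows D" by (rule topspace)
    \<comment> \<open>On arrows \<open>cdom D\<close> is a conjugate of \<open>cdom C\<close>: first
      \<open>G\<close>, then \<open>cdom C\<close>, then \<open>F\<close>. Ranges and products are
      treated in the same way.\<close>
    show "continuous_map (arrow_topology D) (arrow_topology D) (cdom D)"
      by (rule continuous_map_eq[OF continuous_map_compose[OF
          continuous_map_compose[OF G_cont C.continuous_cdom] F_cont]])
        (simp add: topspace flip: cdom[OF G_in], simp add: FG)
    show "continuous_map (arrow_topology D) (arrow_topology D) (cran D)"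
      by (rule continuous_map_eq[OF continuous_map_compose[OF
          continuous_map_compose[OF G_cont C.continuous_cran] F_cont]])
        (simp add: topspace flip: cran[OF G_in], simp add: FG)
    let ?CC = "subtopology (prod_topology (arrow_topology C) (arrow_topology C)) (composable C)"
    let ?DD = "subtopology (prod_topology (arrow_topology D) (arrow_topology D)) (composable D)"
    have "continuous_map ?DD (prod_topology (arrow_topology C) (arrow_topology C))
        (\<lambda>p. (G (fst p), G (snd p)))"
      by (intro continuous_map_from_subtopology continuous_map_pairedI
          continuous_map_compose[OF continuous_map_fst G_cont, unfolded comp_def]
          continuous_map_compose[OF continuous_map_snd G_cont, unfolded comp_def])
    \<comment> \<open>The pair of inverses must land in the subspace \<open>composable C\<close>,
      since continuity of the product of \<open>C\<close> is given only there.\<close>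
    moreover have G_comp: "(G a, G b) \<in> composable C" if ab: "(a, b) \<in> composable D" for a b
    proof -
      obtain x y where xy: "(x, y) \<in> composable C" "a = F x" "b = F y"
        using compE[OF ab] by blast
      moreover have "x \<in> arrows C" "y \<in> arrows C"
        using xy(1) by (auto simp: composable_def)
      ultimately show ?thesis by (simp add: GF)
    qed
    ultimately have "continuous_map ?DD ?CC (\<lambda>p. (G (fst p), G (snd p)))"
      by (auto simp: continuous_map_in_subtopology)
    then show "continuous_map ?DD (arrow_topology D) (\<lambda>(x, y). catmult D x y)"
    proof (rule continuous_map_eq[OF continuous_map_compose[OF continuous_map_compose[OF _
            C.continuous_catmult] F_cont]])
      fix p assume p: "p \<in> topspace ?DD"
      obtain a b where ab: "p = (a, b)" "(a, b) \<in> composable D" using p by (cases p) auto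
      have "F (catmult C (G a) (G b)) = catmult D a b"
        using mult[OF G_comp[OF ab(2)]] ab(2) by (simp add: composable_def FG)
      then show "(F \<circ> ((\<lambda>(x, y). catmult C x y) \<circ> (\<lambda>p. (G (fst p), G (snd p))))) p =
          (case p of (x, y) \<Rightarrow> catmult D x y)"
        by (simp add: ab)
    qed
  qed
qed


section \<open>The transformation category of a partial action\<close>

locale monoid_partial_action = monoid T
  for T :: "('t, 'm) monoid_scheme" (structure) +
  fixes X :: "'x topology" and \<alpha> :: "'t \<Rightarrow> 'x \<rightharpoonup> 'x"
  assumes partial_action: "partial_action T X \<alpha>"
begin

abbreviation "arr \<equiv> transformation_arrows T \<alpha>"
abbreviation "arr_top \<equiv> arrow_topology (transformation_category T X \<alpha>)"

lemma open_dom: "s \<in> carrier T \<Longrightarrow> openin X (dom (\<alpha> s))"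
  and continuous_act:
    "s \<in> carrier T \<Longrightarrow> continuous_map (subtopology X (dom (\<alpha> s))) X (\<lambda>x. the (\<alpha> s x))"
  using partial_action by (auto simp: partial_action_def PT_def Pi_iff)

lemma act_one: "\<alpha> \<one> = Some |` topspace X"
  using partial_action by (simp add: partial_action_def)

lemma dom_subset: "s \<in> carrier T \<Longrightarrow> x \<in> dom (\<alpha> s) \<Longrightarrow> x \<in> topspace X"
  using open_dom openin_subset by blast

lemma act_in_topspace: "s \<in> carrier T \<Longrightarrow> x \<in> dom (\<alpha> s) \<Longrightarrow> the (\<alpha> s x) \<in> topspace X"
  using continuous_act[of s] dom_subset[of s x] by (auto simp: continuous_map_def Pi_iff)

lemma act_mult:
  assumes "s \<in> carrier T" "t \<in> carrier T" "y \<in> dom (\<alpha> t)" "the (\<alpha> t y) \<in> dom (\<alpha> s)"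
  shows "\<alpha> (s \<otimes> t) y = \<alpha> s (the (\<alpha> t y))"
proof -
  have eq: "(\<alpha> s \<circ>\<^sub>m \<alpha> t) y = \<alpha> s (the (\<alpha> t y))"
    using assms(3) by auto
  then have "y \<in> dom (\<alpha> s \<circ>\<^sub>m \<alpha> t)"
    using assms(4) by (simp add: domIff)
  moreover have "\<alpha> s \<circ>\<^sub>m \<alpha> t \<subseteq>\<^sub>m \<alpha> (s \<otimes> t)"
    using partial_action assms(1,2) by (simp add: partial_action_def)
  ultimately show ?thesis using eq by (metis map_le_def)
qed

lemma arr_top_eq: "arr_top = subtopology (prod_topology (discrete_topology (carrier T)) X) arr"
  by (simp add: transformation_category_def)

lemma topspace_top: "topspace arr_top = arr"
  using dom_subset by (auto simp: arr_top_eq transformation_arrows_def)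

text \<open>As \<open>T\<close> is discrete, the arrow space is the disjoint union of its slices
  over \<open>s\<close>. Each slice is a copy of \<open>dom (\<alpha> s)\<close>, which is open in
  \<open>X\<close>, so relative openness in a slice is openness in \<open>X\<close>.\<close>

lemma openin_top_iff:
  "openin arr_top W \<longleftrightarrow> W \<subseteq> arr \<and> (\<forall>s\<in>carrier T. openin X {x. (s, x) \<in> W})"
proof (intro iffI conjI ballI)
  assume W: "openin arr_top W"
  show "W \<subseteq> arr"
    using openin_subset[OF W] topspace_top by simp
  fix s assume s: "s \<in> carrier T"
  obtain V where V: "openin (prod_topology (discrete_topology (carrier T)) X) V" "W = V \<inter> arr"
    using W by (auto simp: arr_top_eq openin_subtopology)
  have "continuous_map X (prod_topology (discrete_topology (carrier T)) X) (\<lambda>x. (s, x))"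
    using s by (simp add: continuous_map_pairwise comp_def)
  then have "openin X {x \<in> topspace X. (s, x) \<in> V}"
    using V(1) by (rule openin_continuous_map_preimage)
  then have "openin X ({x \<in> topspace X. (s, x) \<in> V} \<inter> dom (\<alpha> s))"
    using open_dom[OF s] by (rule openin_Int)
  also have "{x \<in> topspace X. (s, x) \<in> V} \<inter> dom (\<alpha> s) = {x. (s, x) \<in> W}"
    using V(2) s dom_subset[OF s] by (auto simp: transformation_arrows_def iff del: domIff)
  finally show "openin X {x. (s, x) \<in> W}" .
next
  assume W: "W \<subseteq> arr \<and> (\<forall>s\<in>carrier T. openin X {x. (s, x) \<in> W})"
  \<comment> \<open>\<open>W\<close> is the union of its slices, each placed over its own
    \<open>s\<close>; singletons are open in the discrete factor.\<close>
  have "openin (prod_topology (discrete_topology (carrier T)) X)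
      (\<Union>s\<in>carrier T. {s} \<times> {x. (s, x) \<in> W})"
    using W by (intro openin_Union) (auto simp: openin_prod_Times_iff)
  also have "(\<Union>s\<in>carrier T. {s} \<times> {x. (s, x) \<in> W}) = W"
    using W by (auto simp: transformation_arrows_def)
  finally show "openin arr_top W"
    using W by (auto simp: arr_top_eq openin_subtopology)
qed

text \<open>The slices are open and cover the arrows, so preimages may be tested slice by slice; an
  open subset of \<open>dom (\<alpha> s)\<close> is open in \<open>X\<close>.\<close>

lemma continuous_map_from_top:
  assumes "\<And>s. s \<in> carrier T \<Longrightarrow> continuous_map (subtopology X (dom (\<alpha> s))) Y (\<lambda>x. f (s, x))"
  shows "continuous_map arr_top Y f"
  unfolding continuous_map topspace_top
proof (intro conjI allI impI)
  show "f ` arr \<subseteq> topspace Y"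
  proof clarify
    fix s x assume "(s, x) \<in> arr"
    then have "s \<in> carrier T" "x \<in> dom (\<alpha> s)" by (auto simp: transformation_arrows_def)
    then show "f (s, x) \<in> topspace Y"
      using assms[of s] dom_subset[of s x] by (auto simp: continuous_map_def Pi_iff)
  qed
  fix U assume U: "openin Y U"
  have "openin X {x. (s, x) \<in> {p \<in> arr. f p \<in> U}}" if s: "s \<in> carrier T" for s
  proof -
    have "{x. (s, x) \<in> {p \<in> arr. f p \<in> U}} =
        {x \<in> topspace (subtopology X (dom (\<alpha> s))). f (s, x) \<in> U}"
      using s dom_subset[OF s] by (auto simp: transformation_arrows_def iff del: domIff)
    then show ?thesis
      using openin_trans_full[OF openin_continuous_map_preimage[OF assms[OF s] U] open_dom[OF s]]
      by simp
  qed
  then show "openin arr_top {p \<in> arr. f p \<in> U}"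
    by (auto simp: openin_top_iff)
qed

lemma continuous_map_into_top:
  "continuous_map Y arr_top f \<longleftrightarrow> continuous_map Y (discrete_topology (carrier T)) (fst \<circ> f) \<and>
     continuous_map Y X (snd \<circ> f) \<and> f ` topspace Y \<subseteq> arr"
  by (auto simp: arr_top_eq continuous_map_in_subtopology continuous_map_pairwise)

lemma unit_arrow: "x \<in> topspace X \<Longrightarrow> (\<one>, x) \<in> arr"
  by (auto simp: transformation_arrows_def act_one)

theorem topological_category: "topological_category (transformation_category T X \<alpha>)"
    (is "topological_category ?C")
proof
  have fields: "arrows ?C = arr" "units ?C = {\<one>} \<times> topspace X"
    "cdom ?C = (\<lambda>(s, x). (\<one>, x))" "cran ?C = (\<lambda>(s, x). (\<one>, the (\<alpha> s x)))"
    "catmult ?C = (\<lambda>(s, x) (t, y). (s \<otimes> t, y))"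
    by (simp_all add: transformation_category_def)
  have arrD: "s \<in> carrier T" "x \<in> dom (\<alpha> s)" if "(s, x) \<in> arr" for s x
    using that by (auto simp: transformation_arrows_def)
  have comp_iff: "((s, x), (t, y)) \<in> composable ?C \<longleftrightarrow>
      (s, x) \<in> arr \<and> (t, y) \<in> arr \<and> x = the (\<alpha> t y)" for s x t y
    by (auto simp: composable_def fields)
  \<comment> \<open>The inclusion of \<open>\<alpha> s \<circ>\<^sub>m \<alpha> t\<close> in
    \<open>\<alpha> (s \<otimes> t)\<close> makes the product of composable arrows an arrow again,
    with the range of the left factor.\<close>
  have mult: "(s \<otimes> t, y) \<in> arr" "\<alpha> (s \<otimes> t) y = \<alpha> s x"
    if "((s, x), (t, y)) \<in> composable ?C" for s x t y
  proof -
    have *: "s \<in> carrier T" "t \<in> carrier T" "y \<in> dom (\<alpha> t)" "x \<in> dom (\<alpha> s)" "x = the (\<alpha> t y)"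
      using that arrD by (auto simp: comp_iff iff del: domIff)
    then show "\<alpha> (s \<otimes> t) y = \<alpha> s x" using act_mult[of s t y] by blast
    then show "(s \<otimes> t, y) \<in> arr"
      using * by (simp add: transformation_arrows_def domIff)
  qed
  show "units ?C \<subseteq> arrows ?C"
    using unit_arrow by (auto simp: fields)
  show "cdom ?C p \<in> units ?C" "cran ?C p \<in> units ?C"
    "catmult ?C p (cdom ?C p) = p" "catmult ?C (cran ?C p) p = p" if p: "p \<in> arrows ?C" for p
  proof -
    obtain s x where p_eq: "p = (s, x)" by (cases p)
    then have sx: "p = (s, x)" "s \<in> carrier T" "x \<in> dom (\<alpha> s)"
      using p arrD[of s x] by (simp_all only: fields)
    then have "x \<in> topspace X" "the (\<alpha> s x) \<in> topspace X"
      using dom_subset act_in_topspace by blast+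
    then show "cdom ?C p \<in> units ?C" "cran ?C p \<in> units ?C"
      "catmult ?C p (cdom ?C p) = p" "catmult ?C (cran ?C p) p = p"
      using sx(1,2) by (simp_all add: fields)
  qed
  show "cdom ?C p = p" "cran ?C p = p" if "p \<in> units ?C" for p
    using that by (auto simp: fields act_one)
  show "catmult ?C p q \<in> arrows ?C" "cdom ?C (catmult ?C p q) = cdom ?C q"
    "cran ?C (catmult ?C p q) = cran ?C p" if "(p, q) \<in> composable ?C" for p q
    using that mult[of "fst p" "snd p" "fst q" "snd q"]
    by (simp_all add: fields case_prod_unfold)
  show "catmult ?C (catmult ?C p q) r = catmult ?C p (catmult ?C q r)"
    if "(p, q) \<in> composable ?C" "(q, r) \<in> composable ?C" for p q r
    using that by (cases p; cases q; cases r) (auto simp: fields comp_iff arrD m_assoc)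
  show "topspace (arrow_topology ?C) = arrows ?C"
    by (simp add: topspace_top fields)
  have id: "continuous_map (subtopology X A) X (\<lambda>x. x)" for A
    using continuous_map_from_subtopology[OF continuous_map_id] by (simp add: id_def)
  show "continuous_map arr_top arr_top (cdom ?C)"
    by (rule continuous_map_from_top)
      (use unit_arrow id in \<open>auto simp: continuous_map_into_top fields comp_def\<close>)
  show "continuous_map arr_top arr_top (cran ?C)"
    by (rule continuous_map_from_top)
      (use unit_arrow act_in_topspace in
        \<open>auto simp: continuous_map_into_top fields comp_def continuous_act iff del: domIff\<close>)
  let ?CC = "subtopology (prod_topology arr_top arr_top) (composable ?C)"
  \<comment> \<open>Applied to the identity, the criterion for maps into the arrow space yields
    continuity of its two coordinates.\<close>
  have pr: "continuous_map arr_top (discrete_topology (carrier T)) fst" "continuous_map arr_top X snd"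
    using continuous_map_into_top[of arr_top id] by (simp_all add: topspace_top)
  \<comment> \<open>The first coordinate of the product factors through \<open>T\<close> times
    \<open>T\<close>, which is again discrete, so the monoid multiplication is continuous there. The
    second coordinate is that of the right factor.\<close>
  have "continuous_map (prod_topology arr_top arr_top)
      (prod_topology (discrete_topology (carrier T)) (discrete_topology (carrier T)))
      (\<lambda>p. (fst (fst p), fst (snd p)))"
    by (intro continuous_map_pairedI
        continuous_map_compose[OF continuous_map_fst pr(1), unfolded comp_def]
        continuous_map_compose[OF continuous_map_snd pr(1), unfolded comp_def])
  moreover have "continuous_map
      (prod_topology (discrete_topology (carrier T)) (discrete_topology (carrier T)))
      (discrete_topology (carrier T)) (\<lambda>(s, t). s \<otimes> t)"
    by (auto simp flip: prod_topology_discrete_topology)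
  ultimately have "continuous_map ?CC (discrete_topology (carrier T))
      ((\<lambda>(s, t). s \<otimes> t) \<circ> (\<lambda>p. (fst (fst p), fst (snd p))))"
    by (intro continuous_map_from_subtopology continuous_map_compose)
  moreover have "(\<lambda>(s, t). s \<otimes> t) \<circ> (\<lambda>p. (fst (fst p), fst (snd p))) =
      fst \<circ> (\<lambda>(p, q). catmult ?C p q)"
    by (auto simp: fun_eq_iff fields)
  moreover have "continuous_map ?CC X (snd \<circ> snd)"
    by (intro continuous_map_from_subtopology continuous_map_compose[OF continuous_map_snd pr(2)])
  moreover have "snd \<circ> snd = snd \<circ> (\<lambda>(p, q). catmult ?C p q)"
    by (auto simp: fun_eq_iff fields)
  moreover have "(\<lambda>(p, q). catmult ?C p q) ` topspace ?CC \<subseteq> arr"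
    using mult(1) by (auto simp: fields)
  ultimately show "continuous_map ?CC arr_top (\<lambda>(p, q). catmult ?C p q)"
    by (simp add: continuous_map_into_top)
qed

end


section \<open>Germs and sigma-classes\<close>

context proper_action
begin

abbreviation "Q \<equiv> sigma_quotient S"
abbreviation "ind \<equiv> induced_partial_action S \<theta>"

text \<open>An element below \<open>s\<close> is \<open>s\<close> times a projection and hence
  \<sigma>-related to \<open>s\<close>, so a common lower bound forces \<open>s\<close> and
  \<open>t\<close> into one class. Properness enters in the converse, through
  \<open>sigma_compatible\<close>.\<close>

lemma germ_eq_iff_sigma:
  assumes "s \<in> carrier S" "x \<in> dom (\<theta> s)" "t \<in> carrier S" "y \<in> dom (\<theta> t)"
  shows "germ S \<theta> s x = germ S \<theta> t y \<longleftrightarrow> sigma_class S s = sigma_class S t \<and> x = y"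
proof -
  have "(s, t) \<in> sigma_rel S" if "u \<in> carrier S" "natural_le S u s" "natural_le S u t" for u
  proof -
    have "(s, u) \<in> sigma_rel S" "(t, u) \<in> sigma_rel S"
      using sigma_m_proj[OF assms(1) star_proj[OF that(1)]]
        sigma_m_proj[OF assms(3) star_proj[OF that(1)]] that(2,3)
      by (simp_all add: natural_le_def)
    then show ?thesis using sigma_equiv by (meson equivE symD transD)
  qed
  moreover have "\<exists>u\<in>carrier S. natural_le S u s \<and> natural_le S u t \<and> x \<in> dom (\<theta> u)"
    if "(s, t) \<in> sigma_rel S" "x = y"
  proof (intro bexI conjI)
    show "natural_le S (s \<cdot> star S t) s"
      using assms by (intro natural_leI star_proj)
    \<comment> \<open>By \<open>sigma_compatible\<close> the same witness is
      \<open>t \<cdot> star S s\<close>, which lies below \<open>t\<close>.\<close>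
    show "natural_le S (s \<cdot> star S t) t"
      unfolding sigma_compatible[OF that(1) assms(1,3)] using assms by (intro natural_leI star_proj)
    show "x \<in> dom (\<theta> (s \<cdot> star S t))"
      using assms that(2) by (simp add: domIff act_m_star)
    show "s \<cdot> star S t \<in> carrier S"
      using assms by (simp add: m_closed star_closed)
  qed
  ultimately show ?thesis
    unfolding germ_eq_iff[OF assms] sigma_class_eq_iff[OF assms(1,3)] by blast
qed

text \<open>Used to replace an arrow by an element of \<open>S\<close> acting at \<open>x\<close>;
  \<open>\<theta>\<close> of that element then computes the partial action.\<close>

lemma transformation_arrows_iff:
  "(t, x) \<in> transformation_arrows Q ind \<longleftrightarrow>
     (\<exists>s\<in>carrier S. t = sigma_class S s \<and> x \<in> dom (\<theta> s))"
  unfolding transformation_arrows_def dom_induced_partial_action sigma_quotient_carrier by blast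

lemma arrows_germ_category:
  "arrows (germ_category S X \<theta>) = {germ S \<theta> s x |s x. s \<in> carrier S \<and> x \<in> dom (\<theta> s)}"
proof -
  have "germ_domain S \<theta> = {(s, x). s \<in> carrier S \<and> x \<in> dom (\<theta> s)}"
    using germ_domain_iff by blast
  moreover have "germ_domain S \<theta> // germ_rel S \<theta> = (\<lambda>(s, x). germ S \<theta> s x) ` germ_domain S \<theta>"
    by (force simp: quotient_def germ_def)
  ultimately show ?thesis
    by (auto simp: germ_category_def image_iff)
qed

text \<open>\<open>class_germ (t, x)\<close> is the germ \<open>[s, x]\<close> for any \<open>s \<in> t\<close> with \<open>x \<in> dom \<theta>\<^sub>s\<close>.\<close>

definition class_germ :: "'a set \<times> 'x \<Rightarrow> ('a \<times> 'x) set" where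
  "class_germ p = (THE g. \<exists>s\<in>carrier S. sigma_class S s = fst p \<and> snd p \<in> dom (\<theta> s) \<and>
     g = germ S \<theta> s (snd p))"

text \<open>Two representatives of one class, both acting at \<open>x\<close>, have the same germ
  there by \<open>germ_eq_iff_sigma\<close>; this is the uniqueness that the definite description
  requires.\<close>

lemma class_germ_eq:
  assumes "s \<in> carrier S" "x \<in> dom (\<theta> s)"
  shows "class_germ (sigma_class S s, x) = germ S \<theta> s x"
  unfolding class_germ_def fst_conv snd_conv
proof (rule the_equality)
  fix g assume "\<exists>u\<in>carrier S. sigma_class S u = sigma_class S s \<and> x \<in> dom (\<theta> u) \<and>
      g = germ S \<theta> u x"
  then show "g = germ S \<theta> s x"
    using assms germ_eq_iff_sigma by blast
qed (use assms in blast)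

lemma monoid_partial_action: "monoid_partial_action Q X ind"
  by (intro monoid_partial_action.intro monoid_partial_action_axioms.intro
      monoid_sigma_quotient partial_action_induced_partial_action)

sublocale transf: monoid_partial_action Q X ind
  by (rule monoid_partial_action)

lemma class_germ_image: "class_germ ` transformation_arrows Q ind = arrows (germ_category S X \<theta>)"
proof (rule equalityI; rule subsetI)
  fix g assume "g \<in> class_germ ` transformation_arrows Q ind"
  then show "g \<in> arrows (germ_category S X \<theta>)"
    unfolding arrows_germ_category using class_germ_eq
    by (force simp: transformation_arrows_iff iff del: domIff)
next
  fix g assume "g \<in> arrows (germ_category S X \<theta>)"
  then obtain s x where "s \<in> carrier S" "x \<in> dom (\<theta> s)" "g = germ S \<theta> s x"
    unfolding arrows_germ_category by blast
  then show "g \<in> class_germ ` transformation_arrows Q ind"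
    using class_germ_eq transformation_arrows_iff by (metis imageI)
qed

text \<open>Equal germs come from the same class and the same point, by the forward direction of
  \<open>germ_eq_iff_sigma\<close>.\<close>

lemma inj_class_germ: "inj_on class_germ (transformation_arrows Q ind)"
proof (rule inj_onI, clarify)
  fix t x t' x' assume "(t, x) \<in> transformation_arrows Q ind"
    and "(t', x') \<in> transformation_arrows Q ind"
    and eq: "class_germ (t, x) = class_germ (t', x')"
  then obtain s s' where "s \<in> carrier S" "t = sigma_class S s" "x \<in> dom (\<theta> s)"
      "s' \<in> carrier S" "t' = sigma_class S s'" "x' \<in> dom (\<theta> s')"
    unfolding transformation_arrows_iff by blast
  then show "t = t' \<and> x = x'"
    using eq germ_eq_iff_sigma[of s x s' x'] by (simp add: class_germ_eq)
qed

section \<open>Comparison of the two topologies\<close>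

abbreviation germ_basic :: "('a \<times> 'x) set set \<Rightarrow> bool" where
  "germ_basic B \<equiv> \<exists>s\<in>carrier S. \<exists>U.
     openin X U \<and> U \<subseteq> dom (\<theta> (star S s)) \<and> B = germ_basic_open S \<theta> s U"

text \<open>Recasts the basic open sets as images of rectangles, so that continuity and openness of
  \<open>class_germ\<close> can both be read off from rectangles.\<close>

lemma germ_basic_iff: "germ_basic B \<longleftrightarrow>
    (\<exists>s\<in>carrier S. \<exists>U. openin X U \<and> U \<subseteq> dom (\<theta> s) \<and> B = class_germ ` ({sigma_class S s} \<times> U))"
proof -
  have "germ_basic_open S \<theta> s U = class_germ ` ({sigma_class S s} \<times> U)"
    if "s \<in> carrier S" "U \<subseteq> dom (\<theta> s)" for s U
  proof -
    have "germ S \<theta> s ` U = (\<lambda>x. class_germ (sigma_class S s, x)) ` U"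
      using that by (intro image_cong) (auto simp: class_germ_eq subset_iff)
    then show ?thesis by (auto simp: germ_basic_open_def)
  qed
  then show ?thesis by (intro bex_cong ex_cong refl) (auto simp: dom_act_star)
qed

lemma openin_germ_topology_iff:
  "openin (germ_topology S X \<theta>) O' \<longleftrightarrow> (\<exists>\<U>. (\<forall>B\<in>\<U>. germ_basic B) \<and> \<Union>\<U> = O')"
  unfolding openin_germ_topology union_of_def arbitrary_def by auto

lemma topspace_germ_topology: "topspace (germ_topology S X \<theta>) = arrows (germ_category S X \<theta>)"
proof (rule equalityI; rule subsetI)
  fix g assume "g \<in> topspace (germ_topology S X \<theta>)"
  then obtain B where "germ_basic B" "g \<in> B"
    unfolding topspace_def openin_germ_topology_iff by blast
  then obtain s U where "s \<in> carrier S" "U \<subseteq> dom (\<theta> s)" "g \<in> germ S \<theta> s ` U"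
    by (auto simp: germ_basic_open_def dom_act_star)
  then show "g \<in> arrows (germ_category S X \<theta>)"
    unfolding arrows_germ_category by blast
next
  fix g assume "g \<in> arrows (germ_category S X \<theta>)"
  then obtain s x where s: "s \<in> carrier S" "x \<in> dom (\<theta> s)" "g = germ S \<theta> s x"
    unfolding arrows_germ_category by blast
  \<comment> \<open>The domain of \<open>\<theta> s\<close> is open, so it may itself serve as the
    set \<open>U\<close> of a basic open set containing \<open>g\<close>.\<close>
  then have "germ_basic (germ S \<theta> s ` dom (\<theta> s))"
    using act_open[of s] by (auto simp: germ_basic_open_def dom_act_star intro!: bexI[of _ s])
  then have "openin (germ_topology S X \<theta>) (germ S \<theta> s ` dom (\<theta> s))"
    unfolding openin_germ_topology_iff by (intro exI[of _ "{germ S \<theta> s ` dom (\<theta> s)}"]) simp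
  then show "g \<in> topspace (germ_topology S X \<theta>)"
    using s openin_subset by blast
qed

lemma homeomorphic_map_class_germ:
  "homeomorphic_map (arrow_topology (transformation_category Q X ind)) (germ_topology S X \<theta>)
     class_germ"
proof (rule bijective_open_imp_homeomorphic_map)
  show "class_germ ` topspace transf.arr_top = topspace (germ_topology S X \<theta>)"
    by (simp add: transf.topspace_top topspace_germ_topology class_germ_image)
  show "inj_on class_germ (topspace transf.arr_top)"
    by (simp add: transf.topspace_top inj_class_germ)
  have basic_open: "openin transf.arr_top ({sigma_class S s} \<times> U)"
    if s: "s \<in> carrier S" "openin X U" "U \<subseteq> dom (\<theta> s)" for s U
  proof -
    have "openin X {x. (t, x) \<in> {sigma_class S s} \<times> U}" for t
      using s(2) by (cases "t = sigma_class S s") auto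
    moreover have "{sigma_class S s} \<times> U \<subseteq> transformation_arrows Q ind"
      using s transformation_arrows_iff by fast
    ultimately show ?thesis by (simp add: transf.openin_top_iff)
  qed
  show "continuous_map transf.arr_top (germ_topology S X \<theta>) class_germ"
    unfolding continuous_map
  proof (intro conjI allI impI)
    show "class_germ ` topspace transf.arr_top \<subseteq> topspace (germ_topology S X \<theta>)"
      by (simp add: transf.topspace_top topspace_germ_topology class_germ_image)
    fix O' assume "openin (germ_topology S X \<theta>) O'"
    then obtain \<U> where \<U>: "\<And>B. B \<in> \<U> \<Longrightarrow> germ_basic B" "\<Union>\<U> = O'"
      unfolding openin_germ_topology_iff by blast
    have "openin transf.arr_top {p \<in> topspace transf.arr_top. class_germ p \<in> B}" if B: "B \<in> \<U>" for B
    proof -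
      obtain s U where s: "s \<in> carrier S" "openin X U" "U \<subseteq> dom (\<theta> s)"
          "B = class_germ ` ({sigma_class S s} \<times> U)"
        using \<U>(1)[OF B] unfolding germ_basic_iff by blast
      have o: "openin transf.arr_top ({sigma_class S s} \<times> U)"
        using s basic_open by blast
      \<comment> \<open>The rectangle consists of arrows, and \<open>class_germ\<close> is injective
        on arrows, so the preimage of its image is the rectangle itself.\<close>
      have "{p \<in> topspace transf.arr_top. class_germ p \<in> B} = {sigma_class S s} \<times> U"
        unfolding s(4) transf.topspace_top using openin_subset[OF o]
          inj_on_image_mem_iff[OF inj_class_germ _ openin_subset[OF o, unfolded transf.topspace_top]]
        unfolding transf.topspace_top by blast
      then show ?thesis using o by simp
    qed
    then have "openin transf.arr_top (\<Union>B\<in>\<U>. {p \<in> topspace transf.arr_top. class_germ p \<in> B})"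
      by (intro openin_Union) auto
    also have "(\<Union>B\<in>\<U>. {p \<in> topspace transf.arr_top. class_germ p \<in> B}) =
        {p \<in> topspace transf.arr_top. class_germ p \<in> O'}"
      using \<U>(2) by blast
    finally show "openin transf.arr_top {p \<in> topspace transf.arr_top. class_germ p \<in> O'}" .
  qed
  show "open_map transf.arr_top (germ_topology S X \<theta>) class_germ"
    unfolding open_map_def
  proof (intro allI impI)
    fix W assume W: "openin transf.arr_top W"
    \<comment> \<open>The slice of \<open>W\<close> over a class may exceed the domain of any single
      representative, since the induced domain is a union over the class. The slice is therefore cut
      down to \<open>dom (\<theta> s)\<close> and the pieces are indexed by elements of
      \<open>S\<close>; they cover \<open>W\<close> because each arrow has a representative acting
      at its point.\<close>
    define V where "V s = {x. (sigma_class S s, x) \<in> W} \<inter> dom (\<theta> s)" for s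
    have V: "openin X (V s)" "V s \<subseteq> dom (\<theta> s)" if "s \<in> carrier S" for s
      using that W act_open[OF that]
      by (auto simp: V_def transf.openin_top_iff sigma_quotient_carrier)
    have "W = (\<Union>s\<in>carrier S. {sigma_class S s} \<times> V s)"
    proof
      show "W \<subseteq> (\<Union>s\<in>carrier S. {sigma_class S s} \<times> V s)"
      proof clarify
        fix t x assume tx: "(t, x) \<in> W"
        then have "(t, x) \<in> transformation_arrows Q ind"
          using W by (auto simp: transf.openin_top_iff)
        then show "(t, x) \<in> (\<Union>s\<in>carrier S. {sigma_class S s} \<times> V s)"
          using tx unfolding transformation_arrows_iff V_def by blast
      qed
    qed (auto simp: V_def)
    then have "class_germ ` W = (\<Union>s\<in>carrier S. class_germ ` ({sigma_class S s} \<times> V s))"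
      by blast
    moreover have "germ_basic (class_germ ` ({sigma_class S s} \<times> V s))" if "s \<in> carrier S" for s
      unfolding germ_basic_iff using V[OF that] that by blast
    ultimately show "openin (germ_topology S X \<theta>) (class_germ ` W)"
      unfolding openin_germ_topology_iff
      by (intro exI[of _ "(\<lambda>s. class_germ ` ({sigma_class S s} \<times> V s)) ` carrier S"]) auto
  qed
qed

section \<open>Compatibility with the category structure\<close>

lemma class_germ_unit:
  assumes "e \<in> projections S" "x \<in> dom (\<theta> e)"
  shows "class_germ (\<one>\<^bsub>Q\<^esub>, x) = germ S \<theta> e x"
  using class_germ_eq[OF proj_closed[OF assms(1)] assms(2)] by (simp add: sigma_quotient_one[OF assms(1)])

text \<open>Non-degeneracy of the action puts every point \<open>x\<close> in the domain of some
  projection \<open>e\<close>. The class of \<open>e\<close> is the identity of \<open>Q\<close>, so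
  the unit at \<open>x\<close> goes to the germ of \<open>e\<close> at \<open>x\<close>.\<close>

lemma class_germ_units:
  "class_germ ` units (transformation_category Q X ind) = units (germ_category S X \<theta>)"
proof -
  have "class_germ ` ({\<one>\<^bsub>Q\<^esub>} \<times> topspace X) =
      {germ S \<theta> e x |e x. e \<in> projections S \<and> x \<in> dom (\<theta> e)}"
  proof (rule equalityI; rule subsetI)
    fix g assume "g \<in> class_germ ` ({\<one>\<^bsub>Q\<^esub>} \<times> topspace X)"
    then obtain x where "x \<in> topspace X" "g = class_germ (\<one>\<^bsub>Q\<^esub>, x)" by blast
    then show "g \<in> {germ S \<theta> e x |e x. e \<in> projections S \<and> x \<in> dom (\<theta> e)}"
      using act_cover class_germ_unit by blast
  next
    fix g assume "g \<in> {germ S \<theta> e x |e x. e \<in> projections S \<and> x \<in> dom (\<theta> e)}"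
    then obtain e x where e: "e \<in> projections S" "x \<in> dom (\<theta> e)" "g = germ S \<theta> e x" by blast
    moreover have "x \<in> topspace X"
      using e act_open[OF proj_closed] openin_subset by blast
    ultimately show "g \<in> class_germ ` ({\<one>\<^bsub>Q\<^esub>} \<times> topspace X)"
      using class_germ_unit by (metis SigmaI imageI singletonI)
  qed
  then show ?thesis by (simp add: transformation_category_def germ_category_def)
qed

text \<open>Once arrows are replaced by representatives, \<open>germ_cdom_germ\<close>,
  \<open>germ_cran_germ\<close> and \<open>germ_mult_germ\<close> evaluate the structure maps on
  germs, and the results match the computation with classes in \<open>Q\<close>.\<close>

lemma is_functor_class_germ:
  "is_functor (transformation_category Q X ind) (germ_category S X \<theta>) class_germ"
    (is "is_functor ?C ?D _")
  unfolding is_functor_def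
proof (intro conjI ballI)
  have arrC: "arrows ?C = transformation_arrows Q ind"
    by (simp add: transformation_category_def)
  show "class_germ \<in> arrows ?C \<rightarrow> arrows ?D"
    using class_germ_image arrC by blast
  show "class_germ \<in> units ?C \<rightarrow> units ?D"
    using class_germ_units by blast
  fix p assume "p \<in> arrows ?C"
  then obtain s x where s: "s \<in> carrier S" "x \<in> dom (\<theta> s)" "p = (sigma_class S s, x)"
    unfolding arrC by (cases p) (auto simp: transformation_arrows_iff iff del: domIff)
  have "x \<in> dom (\<theta> (star S s))" using s by (simp add: dom_act_star)
  then have "class_germ (\<one>\<^bsub>Q\<^esub>, x) = germ_cdom S \<theta> (germ S \<theta> s x)"
    using s(1,2) germ_cdom_germ class_germ_unit[OF star_proj] by simp
  then show "class_germ (cdom ?C p) = cdom ?D (class_germ p)"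
    using s class_germ_eq by (simp add: transformation_category_def germ_category_def)
  \<comment> \<open>Non-degeneracy supplies a projection at the image point; it represents both the
    range of the germ and the identity class of \<open>Q\<close>.\<close>
  obtain e where e: "e \<in> projections S" "the (\<theta> s x) \<in> dom (\<theta> e)"
    using act_cover act_in_topspace[OF s(1,2)] by blast
  have "ind (sigma_class S s) x = \<theta> s x"
    using s induced_partial_action_eq by blast
  then show "class_germ (cran ?C p) = cran ?D (class_germ p)"
    using s class_germ_eq[OF s(1,2)] class_germ_unit[OF e] germ_cran_germ[OF s(1,2) e]
    by (simp add: transformation_category_def germ_category_def)
next
  have arrC: "arrows ?C = transformation_arrows Q ind"
    by (simp add: transformation_category_def)
  fix pq assume "pq \<in> composable ?C"
  then obtain p q where pq: "pq = (p, q)" "p \<in> arrows ?C" "q \<in> arrows ?C" "cran ?C q = cdom ?C p"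
    by (auto simp: composable_def)
  obtain s x where s: "s \<in> carrier S" "x \<in> dom (\<theta> s)" "p = (sigma_class S s, x)"
    using pq(2) unfolding arrC by (cases p) (auto simp: transformation_arrows_iff iff del: domIff)
  obtain t y where t: "t \<in> carrier S" "y \<in> dom (\<theta> t)" "q = (sigma_class S t, y)"
    using pq(3) unfolding arrC by (cases q) (auto simp: transformation_arrows_iff iff del: domIff)
  have "ind (sigma_class S t) y = \<theta> t y"
    using t induced_partial_action_eq by blast
  \<comment> \<open>Composability of the classes thus becomes composability of the chosen
    representatives, in the form that \<open>germ_mult_germ\<close> expects.\<close>
  then have x: "x = the (\<theta> t y)"
    using pq(4) s(3) t(3) by (simp add: transformation_category_def)
  have "\<theta> (s \<cdot> t) y = \<theta> s x"
    using s(1) t(1,2) x by (auto simp: act_m)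
  then have "y \<in> dom (\<theta> (s \<cdot> t))" using s(2) by (simp add: domIff)
  then have "class_germ (sigma_class S (s \<cdot> t), y) = germ S \<theta> (s \<cdot> t) y"
    using class_germ_eq m_closed s(1) t(1) by blast
  moreover have "germ_mult S \<theta> (germ S \<theta> s x) (germ S \<theta> t y) = germ S \<theta> (s \<cdot> t) y"
    using germ_mult_germ[OF t(1,2) s(1)] s(2) x by simp
  ultimately have "class_germ (catmult ?C p q) = catmult ?D (class_germ p) (class_germ q)"
    using class_germ_eq[OF s(1,2)] class_germ_eq[OF t(1,2)] s t
    by (simp add: transformation_category_def germ_category_def sigma_quotient_mult)
  then show "case pq of (x, y) \<Rightarrow>
      class_germ (catmult ?C x y) = catmult ?D (class_germ x) (class_germ y)"
    by (simp add: pq(1))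
qed

text \<open>The functor \<open>class_germ\<close> serves twice: it transports the axioms to the germ
  category, and it is the required isomorphism.\<close>

theorem isomorphic_germ_category:
  "isomorphic_topological_categories (transformation_category Q X ind) (germ_category S X \<theta>)"
    (is "isomorphic_topological_categories ?C ?D")
proof -
  have top: "arrow_topology ?D = germ_topology S X \<theta>"
    by (simp add: germ_category_def)
  have "topological_category ?D"
    using topological_category_transport[OF transf.topological_category is_functor_class_germ]
    by (simp add: top homeomorphic_map_class_germ class_germ_units topspace_germ_topology)
  then show ?thesis
    unfolding isomorphic_topological_categories_def
    using transf.topological_category is_functor_class_germ homeomorphic_map_class_germ top
    by auto
qed

end

theorem theorem8p3:
  fixes S :: "'a rsemigroup" and X :: "'x topology" and \<theta> :: "'a \<Rightarrow> 'x \<rightharpoonup> 'x"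
  assumes "proper_restriction_semigroup S"
    and "locally_compact_space X" and "Hausdorff_space X"
    and "rs_action S X \<theta>"
  shows "isomorphic_topological_categories
    (transformation_category (sigma_quotient S) X (induced_partial_action S \<theta>))
    (germ_category S X \<theta>)"
proof -
  interpret proper_action S X \<theta>
    using assms by (intro proper_action.intro proper_action_axioms.intro)
  show ?thesis by (rule isomorphic_germ_category)
qed

end
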